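(* Let $X$ be a centered, nondegenerate, infinitely divisible real random variable with finite variance $V>0$ and Lévy measure $\nu$, with $\int_{|x|>1}x^4\,\nu(dx)<\infty$. Let $\kappa_3,\kappa_4$ be the third and fourth cumulants of $X$ and put $$m_1=\mathbb{E}R=\frac{\kappa_3}{3V},\qquad m_2=\mathbb{E}R^2=\frac{\kappa_4}{6V},\qquad \kappa=m_1^2-\frac{m_2}{2}=\frac{\kappa_3^2}{9V^2}-\frac{\kappa_4}{12V}.$$ Assume $\tau>0$, $m_1>0$, $\kappa>0$, that $\Psi_1(t)<m_1$ for every $t>0$, and that $m_1>1/\tau$ when $\tau<\infty$. Then, with $\varepsilon=\theta-1\downarrow0$, $$c_*(\theta V)=m_1-2\sqrt{\kappa\varepsilon}+o(\sqrt{\varepsilon}),$$ and any maximiser $\hat t_\theta$ of $\Psi_\theta$ over $(0,\infty)$ satisfies $\hat t_\theta=\sqrt{\varepsilon/\kappa}\,(1+o(1))$ as $\varepsilon\downarrow0$. In particular $c_*$ has one-sided derivative $-\infty$ at $v=V$, i.e. $\lim_{v\downarrow V}\frac{c_*(v)-c_*(V)}{v-V}=-\infty$.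
   Context: Standing setting: $X$ is a centered, nondegenerate, infinitely divisible real random variable with variance $0<V=\mathrm{Var}(X)<\infty$, Gaussian variance $a\ge0$ and Lévy measure $\nu$ on $\mathbb{R}\setminus\{0\}$. For all real $t$, $K_X(t)=\log\mathbb{E}e^{tX}=\frac{at^2}{2}+\int_{\mathbb{R}\setminus\{0\}}(e^{tx}-1-tx)\,\nu(dx)\in[0,\infty]$, and $V=a+\int x^2\,\nu(dx)$. $\tau=\sup\{t>0:K_X(t)<\infty\}\in[0,\infty]$ (with $\sup\emptyset=0$). Let $H_X(dx)=a\delta_0(dx)+x^2\nu(dx)$ (total mass $V$), let $Z$ have law $H_X/V$, let $B\sim\mathrm{Beta}(1,2)$ (density $2(1-b)$ on $(0,1)$) be independent of $Z$, and put $R=BZ$, $M_R(t)=\mathbb{E}e^{tR}\in(0,\infty]$. For $\theta>0$ and $t>0$, $\Psi_\theta(t)=\frac1t\bigl(1-\frac{\theta}{M_R(t)}\bigr)$. Conventions: $1/0=\infty$, $1/\infty=0$, $\theta/\infty=0$. A pair $(v,c)\in(0,\infty)\times[0,\infty)$ is feasible for $X$ if $K_X(t)\le \frac{vt^2}{2(1-ct)}$ for every $0\le t<1/c$ (for $c=0$: for all $t\ge0$). $c_*(v)=\inf\{c\ge0:(v,c)\text{ is feasible}\}\in[0,\infty]$, with $\inf\emptyset=\infty$. *)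

theory Defs
  imports "HOL-Probability.Probability" "HOL-Library.Landau_Symbols"
begin

definition infinitely_divisible :: "real measure \<Rightarrow> bool" where
  "infinitely_divisible \<mu> \<longleftrightarrow>
     (\<forall>n::nat. 0 < n \<longrightarrow>
        (\<exists>\<rho>. real_distribution \<rho> \<and>
             \<mu> = distr (PiM {..<n} (\<lambda>_. \<rho>)) borel (\<lambda>\<omega>. \<Sum>i<n. \<omega> i)))"

text \<open>A measure on the punctured line is represented by a Borel measure on the line
  that gives no mass to the origin.\<close>

definition levy_measure :: "real measure \<Rightarrow> bool" where
  "levy_measure \<nu> \<longleftrightarrow>
     sets \<nu> = sets borel \<and> emeasure \<nu> {0} = 0 \<and>
     (\<integral>\<^sup>+x. ennreal (min 1 (x\<^sup>2)) \<partial>\<nu>) < \<infinity>"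

text \<open>The law \<open>\<mu>\<close> has Gaussian variance \<open>a\<close> and Levy measure \<open>\<nu>\<close>
  (Levy-Khintchine representation with an unspecified drift \<open>b\<close>).\<close>

definition has_levy_khintchine :: "real measure \<Rightarrow> real \<Rightarrow> real measure \<Rightarrow> bool" where
  "has_levy_khintchine \<mu> a \<nu> \<longleftrightarrow>
     0 \<le> a \<and> levy_measure \<nu> \<and>
     (\<exists>b::real. \<forall>u::real.
        char \<mu> u = exp (\<i> * of_real (b * u) - of_real (a * u\<^sup>2 / 2) +
          (CLINT x|\<nu>. iexp (u * x) - 1 - \<i> * of_real (u * x * indicator {-1..1} x))))"

text \<open>The \<open>n\<close>-th cumulant is the \<open>n\<close>-th derivative at \<open>0\<close> of the logarithm of the
  characteristic function, divided by the \<open>n\<close>-th power of the imaginary unit.  The principal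
  branch suffices since the characteristic function is continuous with value \<open>1\<close> at \<open>0\<close>.\<close>

definition cumulant :: "nat \<Rightarrow> real measure \<Rightarrow> real" where
  "cumulant n \<mu> =
     Re ((((\<lambda>f u. vector_derivative f (at u)) ^^ n) (\<lambda>u. Ln (char \<mu> u)) 0) / \<i> ^ n)"

definition mgf :: "real measure \<Rightarrow> real \<Rightarrow> ennreal" where
  "mgf \<mu> t = (\<integral>\<^sup>+x. ennreal (exp (t * x)) \<partial>\<mu>)"

definition cgf :: "real measure \<Rightarrow> real \<Rightarrow> ereal" where
  "cgf \<mu> t = (if mgf \<mu> t = \<infinity> then \<infinity> else ereal (ln (enn2real (mgf \<mu> t))))"

text \<open>The element \<open>0\<close> implements the convention that the supremum of the empty set is \<open>0\<close>.\<close>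

definition exp_abscissa :: "real measure \<Rightarrow> ereal" where
  "exp_abscissa \<mu> = Sup (insert 0 (ereal ` {t. 0 < t \<and> cgf \<mu> t < \<infinity>}))"

definition levy_H :: "real \<Rightarrow> real measure \<Rightarrow> real measure" where
  "levy_H a \<nu> = measure_of UNIV (sets borel)
     (\<lambda>A. ennreal a * indicator A 0 + (\<integral>\<^sup>+x. ennreal (x\<^sup>2) * indicator A x \<partial>\<nu>))"

text \<open>The set function in the definition above is indeed a measure.\<close>

lemma sets_levy_H [simp, measurable_cong]: "sets (levy_H a \<nu>) = sets borel"
  unfolding levy_H_def using sets.sigma_sets_eq[of borel] by simp

lemma emeasure_levy_H:
  assumes \<nu>: "sets \<nu> = sets borel" and A: "A \<in> sets borel"
  shows "emeasure (levy_H a \<nu>) A =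
    ennreal a * indicator A 0 + (\<integral>\<^sup>+x. ennreal (x\<^sup>2) * indicator A x \<partial>\<nu>)"
    (is "_ = ?m A")
proof -
  let ?N = "density \<nu> (\<lambda>x. ennreal (x\<^sup>2))"
  have sN: "sets ?N = sets borel" using \<nu> by simp
  have meas: "(\<lambda>x. ennreal (x\<^sup>2)) \<in> borel_measurable \<nu>"
    unfolding measurable_cong_sets[OF \<nu> refl] by measurable
  have N: "emeasure ?N B = (\<integral>\<^sup>+x. ennreal (x\<^sup>2) * indicator B x \<partial>\<nu>)" if "B \<in> sets borel" for B
    using that \<nu> meas by (intro emeasure_density) auto
  have D: "emeasure (return borel (0::real)) B = indicator B 0" if "B \<in> sets borel" for B
    using that by simp
  have ca: "countably_additive (sets borel) ?m"
    unfolding countably_additive_def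
  proof (intro allI impI)
    fix F :: "nat \<Rightarrow> real set"
    assume F: "range F \<subseteq> sets borel" "disjoint_family F" "\<Union>(range F) \<in> sets borel"
    have "(\<Sum>i. ?m (F i)) =
        (\<Sum>i. ennreal a * emeasure (return borel 0) (F i) + emeasure ?N (F i))"
      using F(1) by (intro suminf_cong) (simp add: N D range_subsetD)
    also have "\<dots> = ennreal a * (\<Sum>i. emeasure (return borel 0) (F i)) + (\<Sum>i. emeasure ?N (F i))"
      by (simp add: suminf_add[symmetric])
    also have "\<dots> = ennreal a * emeasure (return borel 0) (\<Union>(range F)) + emeasure ?N (\<Union>(range F))"
      using F sN suminf_emeasure[of F "return borel 0"] suminf_emeasure[of F ?N]
      by (simp del: emeasure_return)
    finally show "(\<Sum>i. ?m (F i)) = ?m (\<Union>(range F))"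
      using F(3) by (simp add: N D)
  qed
  have pos: "positive (sets borel) ?m"
    by (simp add: positive_def)
  show ?thesis
    unfolding levy_H_def
    by (rule emeasure_measure_of_sigma[OF _ pos ca A])
       (use sets.sigma_algebra_axioms[of "borel :: real measure"] in simp)
qed

definition beta12 :: "real measure" where
  "beta12 = density lborel (\<lambda>b. ennreal (2 * (1 - b)) * indicator {0<..<1} b)"

text \<open>The law of \<open>R = B Z\<close>, where \<open>B\<close> has law \<open>beta12\<close>, \<open>Z\<close> has law \<open>levy_H a \<nu>\<close> divided
  by its total mass \<open>V\<close>, and independence is the product measure.\<close>

definition law_R :: "real \<Rightarrow> real \<Rightarrow> real measure \<Rightarrow> real measure" where
  "law_R V a \<nu> =
     distr (beta12 \<Otimes>\<^sub>M scale_measure (ennreal (1 / V)) (levy_H a \<nu>)) borel (\<lambda>(b, z). b * z)"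

text \<open>In the extended nonnegative reals a real number divided by infinity is \<open>0\<close>,
  as the convention \<open>\<theta> / \<infinity> = 0\<close> demands.\<close>

definition Psi :: "real measure \<Rightarrow> real \<Rightarrow> real \<Rightarrow> real" where
  "Psi \<rho> \<theta> t = (1 / t) * (1 - enn2real (ennreal \<theta> / mgf \<rho> t))"

definition feasible :: "real measure \<Rightarrow> real \<Rightarrow> real \<Rightarrow> bool" where
  "feasible \<mu> v c \<longleftrightarrow> 0 < v \<and> 0 \<le> c \<and>
     (\<forall>t\<ge>0. (c = 0 \<or> t < 1 / c) \<longrightarrow> cgf \<mu> t \<le> ereal (v * t\<^sup>2 / (2 * (1 - c * t))))"

definition cstar :: "real measure \<Rightarrow> real \<Rightarrow> ereal" where
  "cstar \<mu> v = Inf (ereal ` {c. feasible \<mu> v c})"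

end

theory Submission
  imports Defs
begin

text \<open>
  Put \<open>K(t) = log E exp(t X)\<close> and write \<open>H(dx) = a \<delta>\<^sub>0(dx) + x\<^sup>2 \<nu>(dx)\<close>.  The second-order Taylor
  remainder of the exponential is
  \<open>exp y - 1 - y = (y\<^sup>2 / 2) \<integral>\<^sub>0\<^sup>1 2 (1 - b) exp (b y) db\<close>, so integrating it against \<open>\<nu>\<close> turns the
  Levy-Khintchine exponent into \<open>K(t) = (V t\<^sup>2 / 2) M(t)\<close>, where \<open>M\<close> is the moment generating
  function of \<open>R = B Z\<close>.  Hence the bound \<open>K(t) \<le> \<theta> V t\<^sup>2 / (2 (1 - c t))\<close> on \<open>t < 1 / c\<close> says
  exactly \<open>\<Psi>\<^sub>\<theta>(t) \<le> c\<close>, while for \<open>t \<ge> 1 / c\<close> the latter is automatic because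
  \<open>\<Psi>\<^sub>\<theta>(t) \<le> 1 / t\<close> (lemma \<open>feasible_iff_Psi_le\<close>).  So \<open>c\<^sub>*(\<theta> V)\<close> is the supremum of
  \<open>\<Psi>\<^sub>\<theta>\<close> over \<open>t > 0\<close>, cut off below at \<open>0\<close>.

  Near \<open>0\<close> one has \<open>1 / M(t) = 1 - m\<^sub>1 t + \<kappa> t\<^sup>2 + o(t\<^sup>2)\<close>, which gives
  \<open>\<Psi>\<^sub>1\<^sub>+\<^sub>\<epsilon>(t) = (1 + \<epsilon>) m\<^sub>1 - \<epsilon> / t - (1 + \<epsilon>) (\<kappa> + o(1)) t\<close>.  By the inequality of arithmetic
  and geometric means \<open>\<epsilon> / t + \<kappa> t\<close> has minimum \<open>2 sqrt (\<kappa> \<epsilon>)\<close>, attained at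
  \<open>t = sqrt (\<epsilon> / \<kappa>)\<close>.  Away from \<open>0\<close> nothing competes: \<open>\<Psi>\<^sub>1\<^sub>+\<^sub>\<epsilon> \<le> \<Psi>\<^sub>1\<close>, and \<open>\<Psi>\<^sub>1\<close> stays
  below \<open>m\<^sub>1\<close> by a fixed amount, by compactness up to some finite point \<open>t\<^sub>0\<close> of the domain
  of \<open>M\<close> with \<open>1 / t\<^sub>0 < m\<^sub>1\<close>, and by \<open>\<Psi>\<^sub>1(t) \<le> 1 / t\<close> beyond it.  These estimates are
  carried out for an abstract function in the locales \<open>reciprocal_expansion\<close> and
  \<open>reciprocal_expansion_sup\<close>.

  The identity \<open>K(t) = (V t\<^sup>2 / 2) M(t)\<close> is needed for all \<open>t > 0\<close>, with both sides possibly
  infinite, although only the characteristic function of \<open>X\<close> is given.  It is obtained by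
  constructing, for every finite measure \<open>H\<close>, a law whose characteristic function and moment
  generating function are both the expected exponentials (theorem \<open>kolmogorov_law_exists\<close>).
  Compound Poisson laws serve when \<open>H\<close> has no mass near \<open>0\<close>; for bounded support a weak limit
  of those does, the moment generating functions converging because they are bounded at
  \<open>2 t\<close> as well; a convolution combines the two.  The law of \<open>X\<close> has the same characteristic
  function as the law constructed from its own \<open>H\<close>, so it is that law.  Differentiating the
  exponent at \<open>0\<close> identifies the drift, the mass \<open>V\<close> of \<open>H\<close>, and the cumulants as moments
  of \<open>H\<close>, hence of \<open>R\<close>.
\<close>

section \<open>Transforms of convolutions and compound Poisson laws\<close>

text \<open>With infinite integrals in play, the exponential has to be extended to \<open>\<infinity>\<close> for the formulas
  of the moment generating functions to hold without case distinction.\<close>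

definition exp_ennreal :: "ennreal \<Rightarrow> ennreal" where
  "exp_ennreal x = (if x = \<infinity> then \<infinity> else ennreal (exp (enn2real x)))"

lemma exp_ennreal_ennreal [simp]: "0 \<le> x \<Longrightarrow> exp_ennreal (ennreal x) = ennreal (exp x)"
  by (simp add: exp_ennreal_def)

lemma exp_ennreal_top [simp]: "exp_ennreal \<infinity> = \<infinity>" "exp_ennreal top = top"
  by (simp_all add: exp_ennreal_def)

lemma exp_ennreal_add: "exp_ennreal (x + y) = exp_ennreal x * exp_ennreal y"
  by (cases x; cases y)
     (auto simp: exp_add ennreal_mult ennreal_top_mult ennreal_mult_top simp flip: ennreal_plus)

lemma borel_real_distribution:
  assumes "prob_space N" "sets N = sets borel"
  shows "real_distribution N"
  using assms by (simp add: real_distribution_def real_distribution_axioms_def)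

lemma real_distribution_convolution:
  assumes "real_distribution P" "real_distribution Q"
  shows "real_distribution (P \<star> Q)"
proof -
  interpret P: real_distribution P by fact
  interpret Q: real_distribution Q by fact
  interpret PQ: pair_prob_space P Q ..
  show ?thesis unfolding convolution_def
    by (intro borel_real_distribution PQ.prob_space_distr) auto
qed

lemma mgf_convolution:
  assumes "real_distribution P" "real_distribution Q"
  shows "mgf (P \<star> Q) t = mgf P t * mgf Q t"
proof -
  interpret P: real_distribution P by fact
  interpret Q: real_distribution Q by fact
  have "mgf (P \<star> Q) t = (\<integral>\<^sup>+x. \<integral>\<^sup>+y. ennreal (exp (t * (x + y))) \<partial>Q \<partial>P)"
    unfolding mgf_def by (rule nn_integral_convolution) (simp_all add: P.finite_measure Q.finite_measure)
  also have "\<dots> = (\<integral>\<^sup>+x. \<integral>\<^sup>+y. ennreal (exp (t * x)) * ennreal (exp (t * y)) \<partial>Q \<partial>P)"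
    by (simp add: distrib_left exp_add ennreal_mult)
  also have "\<dots> = mgf P t * mgf Q t"
    unfolding mgf_def by (simp add: nn_integral_cmult nn_integral_multc)
  finally show ?thesis .
qed

lemma char_convolution:
  assumes "real_distribution P" "real_distribution Q"
  shows "char (P \<star> Q) u = char P u * char Q u"
proof -
  interpret P: real_distribution P by fact
  interpret Q: real_distribution Q by fact
  interpret PQ: pair_prob_space P Q ..
  have "char (P \<star> Q) u = (CLINT z|P \<Otimes>\<^sub>M Q. iexp (u * (fst z + snd z)))"
    unfolding convolution_def char_def by (subst integral_distr) (auto simp: case_prod_beta)
  also have "\<dots> = (CLINT x|P. CLINT y|Q. iexp (u * (x + y)))"
  proof -
    have "integrable (P \<Otimes>\<^sub>M Q) (\<lambda>z. iexp (u * (fst z + snd z)))"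
      by (rule PQ.integrable_const_bound[where B=1]) auto
    from PQ.integral_fst'[OF this] show ?thesis by simp
  qed
  also have "\<dots> = (CLINT x|P. CLINT y|Q. iexp (u * x) * iexp (u * y))"
    by (simp add: distrib_left exp_add)
  also have "\<dots> = char P u * char Q u"
    unfolding char_def by simp
  finally show ?thesis .
qed

lemma real_distribution_return: "real_distribution (return borel (c::real))"
  by (intro borel_real_distribution prob_space_return) auto

lemma char_return: "char (return borel c) u = iexp (u * c)"
  unfolding char_def by (subst integral_return) auto

lemma mgf_return: "mgf (return borel c) t = ennreal (exp (t * c))"
  unfolding mgf_def by (subst nn_integral_return) auto

text \<open>The interchange of the mixture with an integral is available for bounded real integrands;
  splitting into cosine and sine carries it over to the characteristic function.\<close>

lemma char_bind:
  assumes N: "N \<in> measurable (measure_pmf p) (subprob_algebra borel)"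
    and prob: "\<And>x. prob_space (N x)"
  shows "char (measure_pmf p \<bind> N) u = (CLINT x|measure_pmf p. char (N x) u)"
proof -
  have sN: "sets (N x) = sets borel" for x
    using measurable_space[OF N, of x] by (simp add: space_subprob_algebra)
  have spN: "emeasure (N x) (space (N x)) = 1" for x
    using prob_space.emeasure_space_1[OF prob] .
  have sb: "sets (measure_pmf p \<bind> N) = sets borel"
    by (rule sets_bind[where N=borel]) (auto simp: sN)
  have pB: "prob_space (measure_pmf p \<bind> N)"
    by (rule prob_space.prob_space_bind[OF measure_pmf.prob_space_axioms _ N]) (simp add: prob)
  have bd: "AE x in measure_pmf p. emeasure (N x) (space (N x)) \<le> ennreal 1"
    by (simp add: spN)
  have real: "(LINT y|(measure_pmf p \<bind> N). f y) = (LINT x|measure_pmf p. LINT y|N x. f y)"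
    if "f \<in> borel_measurable borel" "\<And>y. \<bar>f y\<bar> \<le> 1" for f :: "real \<Rightarrow> real"
    using integral_bind[OF that(1) _ N measure_pmf.finite_measure_axioms bd, of 1] that(2) by auto
  have int: "integrable L (\<lambda>y. iexp (u * y))" if "prob_space L" "sets L = sets borel" for L :: "real measure"
  proof -
    interpret L: prob_space L by fact
    have [measurable_cong]: "sets L = sets borel" by fact
    show ?thesis by (rule L.integrable_const_bound[where B=1]) auto
  qed
  have Re: "Re (char L u) = (LINT y|L. cos (u * y))" and Im: "Im (char L u) = (LINT y|L. sin (u * y))"
    if "prob_space L" "sets L = sets borel" for L :: "real measure"
    using integral_Re[OF int[OF that]] integral_Im[OF int[OF that]]
    by (simp_all add: char_def Re_exp Im_exp)
  have rd: "real_distribution (N x)" for x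
    by (rule borel_real_distribution[OF prob sN])
  have intp: "integrable (measure_pmf p) (\<lambda>x. char (N x) u)"
    by (rule measure_pmf.integrable_const_bound[where B=1])
       (auto intro!: real_distribution.cmod_char_le_1[OF rd])
  show ?thesis
    by (rule complex_eqI)
       (simp_all add: Re[OF pB sb] Im[OF pB sb] real Re[OF prob sN] Im[OF prob sN]
         integral_Re[OF intp, symmetric] integral_Im[OF intp, symmetric] del: integral_Re integral_Im)
qed

text \<open>The law is the Poisson mixture of the convolution powers of \<open>Q\<close>, and both transforms are then
  exponential series.  The factor \<open>exp l\<close> stands on the left of the last identity so that it
  involves no difference of possibly infinite quantities.\<close>

lemma compound_poisson_exists:
  fixes Q :: "real measure" and l :: real
  assumes Q: "real_distribution Q" and l: "0 < l"
  obtains P where "real_distribution P"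
    "\<And>u. char P u = exp (of_real l * (char Q u - 1))"
    "\<And>t. mgf P t * ennreal (exp l) = exp_ennreal (ennreal l * mgf Q t)"
proof -
  define N where "N = rec_nat (return borel (0::real)) (\<lambda>_ K. Q \<star> K)"
  have N0: "N 0 = return borel 0" and NS: "N (Suc k) = (Q \<star> N k)" for k
    by (simp_all add: N_def)
  have rdN: "real_distribution (N k)" for k
    by (induction k) (simp_all add: N0 NS real_distribution_return real_distribution_convolution Q)
  have charN: "char (N k) u = char Q u ^ k" for k u
    by (induction k) (simp_all add: N0 NS char_return char_convolution Q rdN)
  have mgfN: "mgf (N k) t = mgf Q t ^ k" for k t
    by (induction k) (simp_all add: N0 NS mgf_return mgf_convolution Q rdN)
  have probN: "prob_space (N k)" and sN: "sets (N k) = sets borel" for k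
    using rdN[of k] by (simp_all add: real_distribution_def real_distribution_axioms_def)
  let ?p = "poisson_pmf l"
  have meas: "N \<in> measurable (measure_pmf ?p) (subprob_algebra borel)"
    using probN sN by (auto simp: space_subprob_algebra prob_space_imp_subprob_space)
  define P where "P = measure_pmf ?p \<bind> N"
  have "prob_space P" unfolding P_def
    by (rule prob_space.prob_space_bind[OF measure_pmf.prob_space_axioms _ meas]) (simp add: probN)
  moreover have "sets P = sets borel" unfolding P_def
    by (rule sets_bind[where N=borel]) (auto simp: sN)
  ultimately have rdP: "real_distribution P"
    by (rule borel_real_distribution)
  have pk: "pmf ?p k = exp (-l) * (l ^ k / fact k)" for k
    using l by simp
  have charP: "char P u = exp (of_real l * (char Q u - 1))" for u
  proof -
    have q: "norm (char Q u) \<le> 1" by (rule real_distribution.cmod_char_le_1[OF Q])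
    have "char P u = (CLINT k|measure_pmf ?p. char Q u ^ k)"
      unfolding P_def char_bind[OF meas probN] charN ..
    also have "\<dots> = (\<integral>k. pmf ?p k *\<^sub>R char Q u ^ k \<partial>count_space UNIV)"
      unfolding measure_pmf_eq_density by (rule integral_density) auto
    also have "(\<lambda>k. pmf ?p k *\<^sub>R char Q u ^ k) =
        (\<lambda>k. exp (- of_real l) * ((of_real l * char Q u) ^ k /\<^sub>R fact k))"
      by (rule ext) (simp add: pk l scaleR_conv_of_real power_mult_distrib exp_of_real[symmetric] field_simps)
    also have "(\<integral>k. \<dots> k \<partial>count_space UNIV) =
        (\<Sum>k. exp (- of_real l) * ((of_real l * char Q u) ^ k /\<^sub>R fact k))"
    proof (rule integral_count_space_nat)
      have "summable (\<lambda>k. norm (exp (- of_real l) * ((of_real l * char Q u) ^ k /\<^sub>R fact k)))"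
        unfolding norm_mult[where x="exp _"] by (intro summable_mult summable_norm_exp)
      then show "integrable (count_space UNIV) (\<lambda>k. exp (- of_real l) * ((of_real l * char Q u) ^ k /\<^sub>R fact k))"
        by (simp only: integrable_count_space_nat_iff)
    qed
    also have "\<dots> = exp (- of_real l) * exp (of_real l * char Q u)"
      by (subst suminf_mult[OF summable_exp_generic]) (simp add: exp_def)
    also have "\<dots> = exp (of_real l * (char Q u - 1))"
      by (simp add: exp_add[symmetric] algebra_simps)
    finally show ?thesis .
  qed
  have mgfP: "mgf P t * ennreal (exp l) = exp_ennreal (ennreal l * mgf Q t)" for t
  proof -
    have "mgf P t = (\<integral>\<^sup>+k. mgf Q t ^ k \<partial>measure_pmf ?p)"
      unfolding P_def mgf_def by (subst nn_integral_bind[OF _ meas]) (simp_all add: mgfN[unfolded mgf_def])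
    also have "\<dots> = (\<Sum>k. ennreal (pmf ?p k) * mgf Q t ^ k)"
      by (simp add: nn_integral_measure_pmf nn_integral_count_space_nat)
    finally have m: "mgf P t = (\<Sum>k. ennreal (pmf ?p k) * mgf Q t ^ k)" .
    show ?thesis
    proof (cases "mgf Q t")
      case (real r)
      have "mgf P t = (\<Sum>k. ennreal (exp (-l) * ((l * r) ^ k /\<^sub>R fact k)))"
        unfolding m pk using l real
        by (intro suminf_cong) (simp add: ennreal_power ennreal_mult[symmetric] power_mult_distrib field_simps)
      also have "\<dots> = ennreal (\<Sum>k. exp (-l) * ((l * r) ^ k /\<^sub>R fact k))"
        using l real by (intro suminf_ennreal2 summable_mult summable_exp_generic) auto
      also have "(\<Sum>k. exp (-l) * ((l * r) ^ k /\<^sub>R fact k)) = exp (-l) * exp (l * r)"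
        by (subst suminf_mult[OF summable_exp_generic]) (simp add: exp_def)
      finally have "mgf P t * ennreal (exp l) = ennreal (exp (-l) * exp (l * r) * exp l)"
        by (simp add: ennreal_mult)
      also have "exp (-l) * exp (l * r) * exp l = exp (l * r)"
        by (simp add: exp_minus)
      finally show ?thesis using l real by (simp add: ennreal_mult[symmetric])
    next
      case top
      (* The term of a single jump is already infinite. *)
    have "(\<infinity>::ennreal) = ennreal (pmf ?p 1) * mgf Q t ^ 1"
        using top l by (simp add: ennreal_mult_top)
      also have "\<dots> \<le> mgf P t" unfolding m
        using sum_le_suminf[OF summableI, of "{1::nat}" "\<lambda>k. ennreal (pmf ?p k) * mgf Q t ^ k"] by simp
      finally have "mgf P t = \<infinity>" by (simp add: top_unique)
      then show ?thesis using top l by (simp add: ennreal_mult_top ennreal_top_mult)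
    qed
  qed
  show thesis by (rule that[OF rdP charP mgfP])
qed

section \<open>The kernels of the exponents\<close>

text \<open>The integrand of the Levy-Khintchine exponent, divided by \<open>x\<^sup>2\<close> so that it can be integrated
  against \<open>H\<close>; the value at \<open>0\<close> is the continuous extension and produces the Gaussian part.\<close>

definition lk_kernel :: "real \<Rightarrow> real \<Rightarrow> complex" where
  "lk_kernel u x = (if x = 0 then - of_real (u\<^sup>2 / 2)
     else (iexp (u * x) - 1 - \<i> * of_real (u * x)) / of_real (x\<^sup>2))"

definition exp_kernel :: "real \<Rightarrow> real \<Rightarrow> real" where
  "exp_kernel t x = (if x = 0 then t\<^sup>2 / 2 else (exp (t * x) - 1 - t * x) / x\<^sup>2)"

lemma measurable_lk_kernel [measurable]: "lk_kernel u \<in> borel_measurable borel"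
  unfolding lk_kernel_def[abs_def] by measurable

lemma measurable_exp_kernel [measurable]: "exp_kernel t \<in> borel_measurable borel"
  unfolding exp_kernel_def[abs_def] by measurable

lemma norm_iexp_quadratic_le: "norm (iexp y - 1 - \<i> * of_real y) \<le> y\<^sup>2 / 2"
proof -
  have s: "(\<Sum>k\<le>1. (\<i> * of_real y) ^ k / fact k) = 1 + \<i> * of_real y" by simp
  have "\<bar>y\<bar> ^ Suc 1 / fact (Suc 1) = y\<^sup>2 / 2" by (simp add: power2_eq_square)
  with iexp_approx1[of y 1] show ?thesis unfolding s diff_diff_eq by argo
qed

lemma norm_iexp_cubic_le:
  "norm (iexp y - 1 - \<i> * of_real y + of_real (y\<^sup>2 / 2)) \<le> \<bar>y\<bar> ^ 3 / 6"
proof -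
  have s: "(\<Sum>k\<le>2. (\<i> * of_real y) ^ k / fact k) = 1 + \<i> * of_real y - of_real (y\<^sup>2 / 2)"
    by (simp add: atMost_nat_numeral power_mult_distrib)
  have e: "iexp y - (\<Sum>k\<le>2. (\<i> * of_real y) ^ k / fact k) =
      iexp y - 1 - \<i> * of_real y + of_real (y\<^sup>2 / 2)"
    unfolding s by simp
  have f: "\<bar>y\<bar> ^ Suc 2 / fact (Suc 2) = \<bar>y\<bar> ^ 3 / 6"
    by (simp add: fact_numeral eval_nat_numeral)
  show ?thesis
    using iexp_approx1[of y 2] unfolding e f .
qed
lemma norm_lk_kernel_le: "norm (lk_kernel u x) \<le> u\<^sup>2 / 2"
proof (cases "x = 0")
  case False
  have "norm (iexp (u * x) - 1 - \<i> * of_real (u * x)) \<le> (u * x)\<^sup>2 / 2"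
    by (rule norm_iexp_quadratic_le)
  then show ?thesis
    using False by (simp add: lk_kernel_def norm_divide norm_power field_simps)
qed (simp add: lk_kernel_def norm_divide norm_power)

lemma divide_divide_commute: "a / b / c = a / c / (b :: real)"
  by (simp add: mult.commute)

lemma abs_cube_div_square: "(x::real) \<noteq> 0 \<Longrightarrow> \<bar>c * x\<bar> ^ 3 / x\<^sup>2 = \<bar>c\<bar> ^ 3 * \<bar>x\<bar>"
  by (cases "x < 0") (auto simp: abs_mult power_mult_distrib power2_eq_square power3_eq_cube)

lemma lk_kernel_tendsto_0: "(lk_kernel u \<longlongrightarrow> lk_kernel u 0) (at 0)"
proof -
  have "norm (lk_kernel u x - lk_kernel u 0) \<le> \<bar>u\<bar>^3 / 6 * \<bar>x\<bar>" for x
  proof (cases "x = 0")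
    case False
    have e: "norm (iexp (u * x) - 1 - \<i> * of_real (u * x) + of_real ((u * x)\<^sup>2 / 2)) \<le> \<bar>u * x\<bar>^3 / 6"
      by (rule norm_iexp_cubic_le)
    have d: "lk_kernel u x - lk_kernel u 0 =
        (iexp (u * x) - 1 - \<i> * of_real (u * x) + of_real ((u * x)\<^sup>2 / 2)) / of_real (x\<^sup>2)"
      using False by (simp add: lk_kernel_def power_mult_distrib add_divide_distrib)
    have "norm (lk_kernel u x - lk_kernel u 0) \<le> \<bar>u * x\<bar>^3 / 6 / x\<^sup>2"
      unfolding d norm_divide norm_of_real abs_power2 by (rule divide_right_mono[OF e]) simp
    also have "\<dots> = (\<bar>u * x\<bar>^3 / x\<^sup>2) / 6" by (rule divide_divide_commute)
    also have "\<dots> = \<bar>u\<bar>^3 / 6 * \<bar>x\<bar>"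
      unfolding abs_cube_div_square[OF False] by simp
    finally show ?thesis .
  qed simp
  then have "\<forall>x. norm (lk_kernel u x - lk_kernel u 0) \<le> \<bar>u\<bar>^3 / 6 * \<bar>x\<bar>" by blast
  moreover have "((\<lambda>x. \<bar>u\<bar>^3 / 6 * \<bar>x\<bar>) \<longlongrightarrow> 0) (at (0::real))"
    by (auto intro!: tendsto_eq_intros)
  ultimately have "((\<lambda>x. lk_kernel u x - lk_kernel u 0) \<longlongrightarrow> 0) (at 0)"
    by (rule Lim_null_comparison[OF always_eventually])
  then show ?thesis by (simp add: LIM_zero_iff)
qed

lemma exp_taylor_bounds:
  fixes y :: real
  shows "0 \<le> exp y - 1 - y" "exp y - 1 - y \<le> y\<^sup>2 / 2 * exp \<bar>y\<bar>"
    "y \<le> 0 \<Longrightarrow> exp y - 1 - y \<le> y\<^sup>2 / 2"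
    "\<bar>exp y - 1 - y - y\<^sup>2 / 2\<bar> \<le> \<bar>y\<bar>^3 / 6 * exp \<bar>y\<bar>"
proof -
  show "0 \<le> exp y - 1 - y" using exp_ge_add_one_self[of y] by linarith
  obtain s where s: "\<bar>s\<bar> \<le> \<bar>y\<bar>" and "exp y = (\<Sum>m<2. y ^ m / fact m) + exp s / fact 2 * y\<^sup>2"
    using Maclaurin_exp_le[of y 2] by blast
  then have e: "exp y - 1 - y = exp s / 2 * y\<^sup>2" by (simp add: lessThan_nat_numeral)
  have "exp s / 2 * y\<^sup>2 \<le> exp \<bar>y\<bar> / 2 * y\<^sup>2"
    using s by (intro mult_right_mono) auto
  then show "exp y - 1 - y \<le> y\<^sup>2 / 2 * exp \<bar>y\<bar>" unfolding e by (simp add: mult.commute)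
  obtain s where s: "\<bar>s\<bar> \<le> \<bar>y\<bar>" and "exp y = (\<Sum>m<3. y ^ m / fact m) + exp s / fact 3 * y ^ 3"
    using Maclaurin_exp_le[of y 3] by blast
  then have d: "exp y - 1 - y - y\<^sup>2 / 2 = exp s / 6 * y ^ 3"
    by (simp add: lessThan_nat_numeral fact_numeral)
  show "exp y - 1 - y \<le> y\<^sup>2 / 2" if "y \<le> 0"
  proof -
    have "y ^ 3 \<le> 0" using that by (simp add: power_le_zero_eq)
    then have "exp s / 6 * y ^ 3 \<le> 0" by (intro mult_nonneg_nonpos) auto
    then show ?thesis using d by linarith
  qed
  have "\<bar>exp s / 6 * y ^ 3\<bar> = \<bar>y\<bar> ^ 3 / 6 * exp s" by (simp add: abs_mult power_abs)
  also have "\<dots> \<le> \<bar>y\<bar> ^ 3 / 6 * exp \<bar>y\<bar>" using s by (intro mult_left_mono) auto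
  finally show "\<bar>exp y - 1 - y - y\<^sup>2 / 2\<bar> \<le> \<bar>y\<bar>^3 / 6 * exp \<bar>y\<bar>" unfolding d .
qed

lemma exp_kernel_nonneg: "0 \<le> exp_kernel t x"
  using exp_taylor_bounds(1)[of "t * x"] by (simp add: exp_kernel_def)

lemma exp_kernel_le: "exp_kernel t x \<le> t\<^sup>2 / 2 * exp \<bar>t * x\<bar>"
proof (cases "x = 0")
  case False
  have "(exp (t * x) - 1 - t * x) / x\<^sup>2 \<le> ((t * x)\<^sup>2 / 2 * exp \<bar>t * x\<bar>) / x\<^sup>2"
    by (rule divide_right_mono[OF exp_taylor_bounds(2)]) simp
  also have "\<dots> = t\<^sup>2 / 2 * exp \<bar>t * x\<bar>"
    using False by (simp add: power_mult_distrib)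
  finally show ?thesis using False by (simp add: exp_kernel_def)
qed (simp add: exp_kernel_def)

lemma exp_kernel_tendsto_0: "(exp_kernel t \<longlongrightarrow> exp_kernel t 0) (at 0)"
proof -
  have "norm (exp_kernel t x - exp_kernel t 0) \<le> \<bar>t\<bar>^3 / 6 * \<bar>x\<bar> * exp \<bar>t * x\<bar>" for x
  proof (cases "x = 0")
    case False
    have d: "exp_kernel t x - exp_kernel t 0 = (exp (t * x) - 1 - t * x - (t * x)\<^sup>2 / 2) / x\<^sup>2"
      using False by (simp add: exp_kernel_def power_mult_distrib diff_divide_distrib)
    have "norm (exp_kernel t x - exp_kernel t 0) \<le> \<bar>t * x\<bar>^3 / 6 * exp \<bar>t * x\<bar> / x\<^sup>2"
      unfolding d real_norm_def abs_divide abs_power2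
      by (rule divide_right_mono[OF exp_taylor_bounds(4)]) simp
    also have "\<dots> = (\<bar>t * x\<bar>^3 / x\<^sup>2) / 6 * exp \<bar>t * x\<bar>"
      by (simp only: times_divide_eq_left divide_divide_eq_left mult.commute[of 6])
    also have "\<dots> = \<bar>t\<bar>^3 / 6 * \<bar>x\<bar> * exp \<bar>t * x\<bar>"
      unfolding abs_cube_div_square[OF False] by simp
    finally show ?thesis .
  qed simp
  then have "\<forall>x. norm (exp_kernel t x - exp_kernel t 0) \<le> \<bar>t\<bar>^3 / 6 * \<bar>x\<bar> * exp \<bar>t * x\<bar>" by blast
  moreover have "((\<lambda>x. \<bar>t\<bar>^3 / 6 * \<bar>x\<bar> * exp \<bar>t * x\<bar>) \<longlongrightarrow> 0) (at (0::real))"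
    by (auto intro!: tendsto_eq_intros)
  ultimately have "((\<lambda>x. exp_kernel t x - exp_kernel t 0) \<longlongrightarrow> 0) (at 0)"
    by (rule Lim_null_comparison[OF always_eventually])
  then show ?thesis by (simp add: LIM_zero_iff)
qed

lemma integrable_lk_kernel:
  assumes "finite_measure H" "sets H = sets borel"
  shows "integrable H (lk_kernel u)"
  using assms by (intro finite_measure.integrable_const_bound[where B="u\<^sup>2 / 2"])
    (auto intro!: AE_I2 norm_lk_kernel_le simp: measurable_cong_sets[OF assms(2) refl] simp del: le_divide_eq_numeral1)

section \<open>Construction of laws in Kolmogorov form\<close>

text \<open>Kolmogorov's canonical form of a centered infinitely divisible law of finite variance, stated
  for both transforms at once.  The moment generating function may be infinite.\<close>

definition kolmogorov_law :: "real measure \<Rightarrow> real measure \<Rightarrow> bool" where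
  "kolmogorov_law P H \<longleftrightarrow> real_distribution P \<and>
     (\<forall>u. char P u = exp (CLINT x|H. lk_kernel u x)) \<and>
     (\<forall>t. mgf P t = exp_ennreal (\<integral>\<^sup>+x. ennreal (exp_kernel t x) \<partial>H))"

text \<open>Here \<open>x\<^sup>-\<^sup>2 H(dx)\<close> is a finite jump measure with finite mean, so the compound Poisson law with
  these jumps, recentered by the deterministic shift \<open>d\<close>, has the required exponents.\<close>

lemma kolmogorov_law_away_from_0:
  assumes fin: "finite_measure H" and sets[measurable_cong]: "sets H = sets borel"
    and r: "0 < r" and away: "AE x in H. r \<le> \<bar>x\<bar>"
  shows "\<exists>P. kolmogorov_law P H"
proof -
  interpret H: finite_measure H by fact
  define w where "w = (\<lambda>x::real. 1 / x\<^sup>2)"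
  have [measurable]: "w \<in> borel_measurable borel" unfolding w_def by measurable
  have iw: "integrable H w"
  proof (rule H.integrable_const_bound[where B="1 / r\<^sup>2"])
    show "AE x in H. norm (w x) \<le> 1 / r\<^sup>2"
      using away
    proof eventually_elim
      case (elim x)
      then have "r\<^sup>2 \<le> x\<^sup>2" using r by (metis abs_le_square_iff abs_of_pos)
      then show ?case using r by (simp add: w_def frac_le)
    qed
  qed simp
  have ii: "integrable H (\<lambda>x. 1 / x)"
  proof (rule H.integrable_const_bound[where B="1 / r"])
    show "AE x in H. norm (1 / x) \<le> 1 / r"
      using away by eventually_elim (use r in \<open>simp add: frac_le\<close>)
  qed simp
  define l where "l = (LINT x|H. w x)"
  define d where "d = - (LINT x|H. 1 / x)"
  have w0: "0 \<le> w x" for x by (simp add: w_def)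
  have l0: "0 \<le> l" unfolding l_def by (rule integral_nonneg_AE) (simp add: w0)
  show ?thesis
  proof (cases "l = 0")
    case True
    have "AE x in H. w x = 0"
      using True integral_nonneg_eq_0_iff_AE[OF iw] w0 unfolding l_def by simp
    with away have F: "AE x in H. False"
      by eventually_elim (use r in \<open>auto simp: w_def\<close>)
    have "(CLINT x|H. lk_kernel u x) = 0" for u
      by (rule integral_eq_zero_AE) (use F in \<open>auto elim: eventually_mono\<close>)
    moreover have "(\<integral>\<^sup>+x. ennreal (exp_kernel t x) \<partial>H) = 0" for t
      by (subst nn_integral_0_iff_AE) (use F in \<open>auto elim: eventually_mono\<close>)
    ultimately have "kolmogorov_law (return borel 0) H"
      using exp_ennreal_ennreal[of 0]
      by (simp add: kolmogorov_law_def real_distribution_return char_return mgf_return)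
    then show ?thesis ..
  next
    case False
    then have l: "0 < l" using l0 by simp
    define Q where "Q = density H (\<lambda>x. ennreal (w x / l))"
    have sQ: "sets Q = sets borel" unfolding Q_def using sets by simp
    have rdQ: "real_distribution Q"
    proof (rule borel_real_distribution[OF prob_spaceI sQ])
      have "emeasure Q (space Q) = (\<integral>\<^sup>+x. ennreal (w x / l) \<partial>H)"
        unfolding Q_def by (subst emeasure_density) (auto intro!: nn_integral_cong)
      also have "\<dots> = ennreal (LINT x|H. w x / l)"
        using iw l w0 by (intro nn_integral_eq_integral) auto
      also have "(LINT x|H. w x / l) = 1" using l by (simp add: l_def)
      finally show "emeasure Q (space Q) = 1" by simp
    qed
    obtain P where P: "real_distribution P"
      and cP: "\<And>u. char P u = exp (of_real l * (char Q u - 1))"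
      and mP: "\<And>t. mgf P t * ennreal (exp l) = exp_ennreal (ennreal l * mgf Q t)"
      using compound_poisson_exists[OF rdQ l] by blast
    define P' where "P' = (P \<star> return borel d)"
    have "real_distribution P'"
      unfolding P'_def by (intro real_distribution_convolution P real_distribution_return)
    moreover have "char P' u = exp (CLINT x|H. lk_kernel u x)" for u
    proof -
      have iq: "complex_integrable H (\<lambda>x. w x *\<^sub>R iexp (u * x))"
        by (rule Bochner_Integration.integrable_bound[OF iw]) (auto simp: w0)
      have "of_real l * char Q u = of_real l * (CLINT x|H. (w x / l) *\<^sub>R iexp (u * x))"
        unfolding char_def Q_def using l w0 by (subst integral_density) auto
      also have "\<dots> = (CLINT x|H. of_real l * ((w x / l) *\<^sub>R iexp (u * x)))"
        by (rule integral_mult_right_zero[symmetric])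
      also have "\<dots> = (CLINT x|H. w x *\<^sub>R iexp (u * x))"
        using l by (intro Bochner_Integration.integral_cong) (auto simp: scaleR_conv_of_real)
      finally have a: "of_real l * char Q u = (CLINT x|H. w x *\<^sub>R iexp (u * x))" .
      have "(CLINT x|H. lk_kernel u x) =
          (CLINT x|H. w x *\<^sub>R iexp (u * x) - of_real (w x) - \<i> * of_real u * of_real (1 / x))"
      proof (rule integral_cong_AE)
        show "AE x in H. lk_kernel u x = w x *\<^sub>R iexp (u * x) - of_real (w x) - \<i> * of_real u * of_real (1 / x)"
          using away by eventually_elim
            (use r in \<open>auto simp: lk_kernel_def w_def scaleR_conv_of_real field_simps power2_eq_square\<close>)
      qed simp_all
      also have "\<dots> = of_real l * char Q u - of_real l + \<i> * of_real u * of_real d"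
      proof -
        have i1: "complex_integrable H (\<lambda>x. of_real (w x))"
          using iw by (simp add: complex_of_real_integrable_eq)
        have i2: "complex_integrable H (\<lambda>x. \<i> * of_real u * of_real (1 / x))"
          using ii by (intro integrable_mult_right) (simp only: complex_of_real_integrable_eq)
        have "(CLINT x|H. \<i> * of_real u * of_real (1 / x)) = - (\<i> * of_real u * of_real d)"
          unfolding d_def
          by (simp only: integral_mult_right_zero integral_complex_of_real) simp
        then show ?thesis
          by (simp only: Bochner_Integration.integral_diff[OF Bochner_Integration.integrable_diff[OF iq i1] i2]
              Bochner_Integration.integral_diff[OF iq i1] a[symmetric] integral_complex_of_real l_def[symmetric]) simp
      qed
      finally have "(CLINT x|H. lk_kernel u x) = of_real l * (char Q u - 1) + \<i> * of_real (u * d)"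
        by (simp add: right_diff_distrib mult.assoc)
      then have "exp (CLINT x|H. lk_kernel u x) =
          exp (of_real l * (char Q u - 1)) * exp (\<i> * of_real (u * d))"
        by (simp only: exp_add)
      then show ?thesis
        unfolding P'_def by (simp add: char_convolution P real_distribution_return cP char_return)
    qed
    moreover have "mgf P' t = exp_ennreal (\<integral>\<^sup>+x. ennreal (exp_kernel t x) \<partial>H)" for t
    proof -
      have a: "ennreal l * mgf Q t = (\<integral>\<^sup>+x. ennreal (w x * exp (t * x)) \<partial>H)"
      proof -
        have "mgf Q t = (\<integral>\<^sup>+x. ennreal (w x / l) * ennreal (exp (t * x)) \<partial>H)"
          unfolding mgf_def Q_def by (subst nn_integral_density) auto
        also have "ennreal l * \<dots> = (\<integral>\<^sup>+x. ennreal l * (ennreal (w x / l) * ennreal (exp (t * x))) \<partial>H)"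
          by (rule nn_integral_cmult[symmetric]) simp
        also have "\<dots> = (\<integral>\<^sup>+x. ennreal (w x * exp (t * x)) \<partial>H)"
          using l w0 by (intro nn_integral_cong) (simp add: ennreal_mult[symmetric])
        finally show ?thesis .
      qed
      have k: "AE x in H. exp_kernel t x = w x * exp (t * x) - w x - t * (1 / x)"
        using away by eventually_elim
          (use r in \<open>auto simp: exp_kernel_def w_def field_simps power2_eq_square\<close>)
      have mP': "mgf P' t = mgf P t * ennreal (exp (t * d))"
        unfolding P'_def by (simp add: mgf_convolution P real_distribution_return mgf_return)
      have mP'': "mgf P t = exp_ennreal (ennreal l * mgf Q t) * ennreal (exp (- l))"
      proof -
        have "mgf P t = mgf P t * (ennreal (exp l) * ennreal (exp (- l)))"
          by (simp add: ennreal_mult[symmetric] exp_minus)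
        also have "\<dots> = exp_ennreal (ennreal l * mgf Q t) * ennreal (exp (- l))"
          by (simp add: mP[symmetric] mult.assoc)
        finally show ?thesis .
      qed
      show ?thesis
      proof (cases "integrable H (\<lambda>x. w x * exp (t * x))")
        case True
        define I where "I = (LINT x|H. w x * exp (t * x))"
        have I: "ennreal l * mgf Q t = ennreal I" "0 \<le> I"
          unfolding a I_def using True w0 by (auto intro!: nn_integral_eq_integral integral_nonneg)
        have ik: "integrable H (exp_kernel t)"
        proof (subst integrable_cong_AE[OF _ _ k])
          show "integrable H (\<lambda>x. w x * exp (t * x) - w x - t * (1 / x))"
            using True iw ii by (intro Bochner_Integration.integrable_diff integrable_mult_right)
        qed simp_all
        have "(LINT x|H. exp_kernel t x) = (LINT x|H. w x * exp (t * x) - w x - t * (1 / x))"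
          by (rule integral_cong_AE[OF _ _ k]) simp_all
        also have "\<dots> = I - l + t * d"
          unfolding I_def l_def d_def
            Bochner_Integration.integral_diff[OF Bochner_Integration.integrable_diff[OF True iw] integrable_mult_right[OF ii]]
            Bochner_Integration.integral_diff[OF True iw] integral_mult_right_zero by simp
        finally have K: "(LINT x|H. exp_kernel t x) = I - l + t * d" .
        have "0 \<le> (LINT x|H. exp_kernel t x)"
          by (simp add: exp_kernel_nonneg)
        moreover have "(\<integral>\<^sup>+x. ennreal (exp_kernel t x) \<partial>H) = ennreal (I - l + t * d)"
          unfolding K[symmetric] by (rule nn_integral_eq_integral[OF ik]) (simp add: exp_kernel_nonneg)
        ultimately have "exp_ennreal (\<integral>\<^sup>+x. ennreal (exp_kernel t x) \<partial>H) = ennreal (exp (I - l + t * d))"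
          using K by simp
        also have "\<dots> = mgf P' t"
          unfolding mP' mP'' I using I(2)
          by (simp add: ennreal_mult[symmetric] exp_add exp_diff exp_minus field_simps)
        finally show ?thesis ..
      next
        case False
        have "\<not> integrable H (exp_kernel t)"
        proof
          assume *: "integrable H (exp_kernel t)"
          have "integrable H (\<lambda>x. w x * exp (t * x))"
          proof (subst integrable_cong_AE)
            show "AE x in H. w x * exp (t * x) = exp_kernel t x + w x + t * (1 / x)"
              using k by eventually_elim simp
            show "integrable H (\<lambda>x. exp_kernel t x + w x + t * (1 / x))"
              using * iw ii by (intro Bochner_Integration.integrable_add integrable_mult_right)
          qed simp_all
          with False show False ..
        qed
        then have "(\<integral>\<^sup>+x. ennreal (exp_kernel t x) \<partial>H) = \<infinity>"
          by (simp add: integrable_iff_bounded exp_kernel_nonneg less_top[symmetric])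
        moreover have "ennreal l * mgf Q t = \<infinity>"
          unfolding a using False by (simp add: integrable_iff_bounded w0 less_top[symmetric])
        ultimately show ?thesis
          unfolding mP' mP'' by (simp add: ennreal_top_mult)
      qed
    qed
    ultimately have "kolmogorov_law P' H" by (simp add: kolmogorov_law_def)
    then show ?thesis ..
  qed
qed

text \<open>Exponential Markov inequality in both directions.\<close>

lemma tight_of_mgf_bound:
  assumes P: "\<And>n. real_distribution (P n)"
    and B: "\<And>n. mgf (P n) 1 \<le> ennreal B" "\<And>n. mgf (P n) (-1) \<le> ennreal B"
  shows "tight P"
  unfolding tight_def
proof (intro conjI allI impI P)
  fix \<epsilon> :: real assume "0 < \<epsilon>"
  have "((\<lambda>K. exp (- K) * (2 * \<bar>B\<bar>)) \<longlongrightarrow> 0 * (2 * \<bar>B\<bar>)) at_top"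
    by (intro tendsto_mult tendsto_const filterlim_compose[OF exp_at_bot] filterlim_uminus_at_bot_at_top)
  then have "eventually (\<lambda>K. exp (- K) * (2 * \<bar>B\<bar>) < \<epsilon>) at_top"
    using \<open>0 < \<epsilon>\<close> by (intro order_tendstoD(2)) simp_all
  then have "eventually (\<lambda>K. 0 < K \<and> exp (- K) * (2 * \<bar>B\<bar>) < \<epsilon>) at_top"
    using eventually_gt_at_top[of 0] by eventually_elim simp
  then obtain K where K: "0 < K" "exp (- K) * (2 * \<bar>B\<bar>) < \<epsilon>"
    by (auto simp: eventually_at_top_linorder)
  have "1 - \<epsilon> < measure (P n) {-K<..K}" for n
  proof -
    interpret real_distribution "P n" by (rule P)
    have "emeasure (P n) (- {-K<..K}) = (\<integral>\<^sup>+x. indicator (- {-K<..K}) x \<partial>P n)"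
      by simp
    also have "\<dots> \<le> (\<integral>\<^sup>+x. ennreal (exp (- K)) * (ennreal (exp (1 * x)) + ennreal (exp (-1 * x))) \<partial>P n)"
    proof (rule nn_integral_mono)
      fix x
      show "indicator (- {-K<..K}) x \<le> ennreal (exp (- K)) * (ennreal (exp (1 * x)) + ennreal (exp (-1 * x)))"
      proof (cases "x \<in> {-K<..K}")
        case False
        then have "1 \<le> exp (- K + x) \<or> 1 \<le> exp (- K - x)" by auto
        then have "1 \<le> exp (- K + x) + exp (- K - x)"
          using exp_ge_zero[of "- K + x"] exp_ge_zero[of "- K - x"] by linarith
        also have "\<dots> = exp (- K) * (exp x + exp (- x))"
          by (simp add: distrib_left exp_add[symmetric])
        finally have "1 \<le> ennreal (exp (- K) * (exp x + exp (- x)))" by simp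
        with False show ?thesis by (simp add: ennreal_mult)
      qed simp
    qed
    also have "\<dots> = ennreal (exp (- K)) * (mgf (P n) 1 + mgf (P n) (-1))"
      unfolding mgf_def by (subst nn_integral_cmult) (simp_all add: nn_integral_add)
    also have "\<dots> \<le> ennreal (exp (- K)) * (ennreal \<bar>B\<bar> + ennreal \<bar>B\<bar>)"
      by (intro mult_left_mono add_mono order_trans[OF B(1)] order_trans[OF B(2)] ennreal_leI) auto
    also have "\<dots> = ennreal (exp (- K) * (2 * \<bar>B\<bar>))"
      by (simp add: ennreal_mult[symmetric] ennreal_plus[symmetric] del: ennreal_plus)
    finally have "measure (P n) (- {-K<..K}) \<le> exp (- K) * (2 * \<bar>B\<bar>)"
      by (simp add: emeasure_eq_measure)
    moreover have "measure (P n) (- {-K<..K}) = 1 - measure (P n) {-K<..K}"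
      using prob_compl[of "{-K<..K}"] by (simp add: Compl_eq_Diff_UNIV)
    ultimately show ?thesis using K by linarith
  qed
  with K(1) show "\<exists>a b. a < b \<and> (\<forall>n. 1 - \<epsilon> < measure (P n) {a<..b})"
    by (intro exI[of _ "-K"] exI[of _ K]) auto
qed

text \<open>Weak convergence only controls the truncations \<open>min (exp (t x)) k\<close>.  The part cut off is at
  most \<open>exp (2 t x) / k\<close>, so a uniform bound at \<open>2 t\<close> makes the truncation error uniform in
  \<open>n\<close>.\<close>

lemma mgf_weak_limit:
  assumes Pn: "\<And>n. real_distribution (P n)" and P': "real_distribution P'"
    and conv: "weak_conv_m P P'"
    and m: "\<And>n. mgf (P n) t = ennreal (L n)" "\<And>n. 0 \<le> L n" and L: "L \<longlonglongrightarrow> L'"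
    and B: "\<And>n. mgf (P n) (2 * t) \<le> ennreal B" and B0: "0 \<le> B"
  shows "mgf P' t = ennreal L'"
proof -
  interpret P': real_distribution P' by fact
  define f where "f = (\<lambda>k x. min (exp (t * x)) (real k))"
  have f0: "0 \<le> f k x" and fk: "f k x \<le> real k" for k x by (auto simp: f_def)
  have [measurable]: "f k \<in> borel_measurable borel" for k unfolding f_def by measurable
  have f_int: "integrable Q (f k)" if "real_distribution Q" for Q k
  proof -
    interpret Q: real_distribution Q by fact
    show ?thesis by (rule Q.integrable_const_bound[where B=k]) (auto simp: f0 fk)
  qed
  have lim: "(\<lambda>n. integral\<^sup>L (P n) (f k)) \<longlonglongrightarrow> integral\<^sup>L P' (f k)" for k
  proof (rule weak_conv_imp_integral_bdd_continuous_conv[OF Pn P' conv, where B=k])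
    show "isCont (f k) x" for x unfolding f_def by (intro continuous_intros)
  qed (simp add: f0 fk)
  have int: "integrable (P n) (\<lambda>x. exp (t * x))" "(LINT x|P n. exp (t * x)) = L n" for n
  proof -
    interpret Pn: real_distribution "P n" by (rule Pn)
    show "integrable (P n) (\<lambda>x. exp (t * x))"
      using m(1)[of n] by (intro integrableI_nonneg) (auto simp: mgf_def)
    then have "ennreal (LINT x|P n. exp (t * x)) = ennreal (L n)"
      using m(1)[of n] nn_integral_eq_integral[of "P n" "\<lambda>x. exp (t * x)"] by (simp add: mgf_def)
    then show "(LINT x|P n. exp (t * x)) = L n"
      using m(2) by (subst (asm) ennreal_inj) auto
  qed
  have int2: "integrable (P n) (\<lambda>x. exp (2 * t * x))" "(LINT x|P n. exp (2 * t * x)) \<le> B" for n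
  proof -
    interpret Pn: real_distribution "P n" by (rule Pn)
    show i: "integrable (P n) (\<lambda>x. exp (2 * t * x))"
      using B[of n] by (intro integrableI_nonneg) (auto simp: mgf_def le_less_trans)
    then have "ennreal (LINT x|P n. exp (2 * t * x)) \<le> ennreal B"
      using B[of n] nn_integral_eq_integral[OF i] by (simp add: mgf_def)
    then show "(LINT x|P n. exp (2 * t * x)) \<le> B"
      using B0 by (simp add: ennreal_le_iff)
  qed
  have up: "integral\<^sup>L P' (f k) \<le> L'" for k
  proof (rule LIMSEQ_le[OF lim L])
    have "integral\<^sup>L (P n) (f k) \<le> L n" for n
      unfolding int(2)[symmetric] by (intro integral_mono f_int Pn int) (simp add: f_def)
    then show "\<exists>N. \<forall>n\<ge>N. integral\<^sup>L (P n) (f k) \<le> L n" by blast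
  qed
  have low: "L' - B / real k \<le> integral\<^sup>L P' (f k)" if k: "0 < k" for k
  proof (rule LIMSEQ_le[OF _ lim])
    show "(\<lambda>n. L n - B / real k) \<longlonglongrightarrow> L' - B / real k" by (intro tendsto_intros L)
    have "L n - B / real k \<le> integral\<^sup>L (P n) (f k)" for n
    proof -
      have "L n \<le> (LINT x|P n. f k x + exp (2 * t * x) / real k)"
        unfolding int(2)[symmetric]
      proof (intro integral_mono int Bochner_Integration.integrable_add f_int Pn integrable_divide int2)
        fix x
        show "exp (t * x) \<le> f k x + exp (2 * t * x) / real k"
        proof (cases "exp (t * x) \<le> real k")
          case False
          have "exp (t * x) * real k \<le> exp (t * x) * exp (t * x)"
            using False by (intro mult_left_mono) auto
          then have "exp (t * x) \<le> exp (2 * t * x) / real k"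
            using k by (simp add: pos_le_divide_eq exp_add[symmetric] mult.assoc)
          then show ?thesis using f0[of k x] by linarith
        qed (simp add: f_def)
      qed
      also have "\<dots> = integral\<^sup>L (P n) (f k) + (LINT x|P n. exp (2 * t * x)) / real k"
        by (simp add: f_int Pn int2)
      also have "\<dots> \<le> integral\<^sup>L (P n) (f k) + B / real k"
        by (intro add_left_mono divide_right_mono int2) simp
      finally show ?thesis by linarith
    qed
    then show "\<exists>N. \<forall>n\<ge>N. L n - B / real k \<le> integral\<^sup>L (P n) (f k)" by blast
  qed
  have "(\<lambda>k. integral\<^sup>L P' (f k)) \<longlonglongrightarrow> L'"
  proof (rule tendsto_sandwich[OF _ _ _ tendsto_const])
    show "eventually (\<lambda>k. L' - B / real k \<le> integral\<^sup>L P' (f k)) sequentially"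
      using eventually_gt_at_top[of 0] by eventually_elim (rule low)
    show "eventually (\<lambda>k. integral\<^sup>L P' (f k) \<le> L') sequentially" by (simp add: up)
    have "(\<lambda>k. L' - B / real k) \<longlonglongrightarrow> L' - 0"
      by (intro tendsto_intros tendsto_divide_0[OF tendsto_const] filterlim_at_top_imp_at_infinity
          filterlim_real_sequentially)
    then show "(\<lambda>k. L' - B / real k) \<longlonglongrightarrow> L'" by simp
  qed
  then have "(\<lambda>k. ennreal (integral\<^sup>L P' (f k))) \<longlonglongrightarrow> ennreal L'" by (rule tendsto_ennrealI)
  also have "(\<lambda>k. ennreal (integral\<^sup>L P' (f k))) = (\<lambda>k. \<integral>\<^sup>+x. ennreal (f k x) \<partial>P')"
    by (rule ext, rule nn_integral_eq_integral[symmetric]) (auto simp: f_int P' f0)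
  finally have 1: "(\<lambda>k. \<integral>\<^sup>+x. ennreal (f k x) \<partial>P') \<longlonglongrightarrow> ennreal L'" .
  have "(\<lambda>k. \<integral>\<^sup>+x. ennreal (f k x) \<partial>P') \<longlonglongrightarrow> (\<integral>\<^sup>+x. ennreal (exp (t * x)) \<partial>P')"
  proof (rule nn_integral_LIMSEQ)
    show "incseq (\<lambda>k x. ennreal (f k x))"
      by (auto simp: incseq_def le_fun_def f_def intro!: ennreal_leI min.mono)
    fix x
    have "eventually (\<lambda>k. exp (t * x) \<le> real k) sequentially"
      using filterlim_real_sequentially by (simp add: filterlim_at_top)
    then have "eventually (\<lambda>k. ennreal (f k x) = ennreal (exp (t * x))) sequentially"
      by eventually_elim (simp add: f_def)
    then show "(\<lambda>k. ennreal (f k x)) \<longlonglongrightarrow> ennreal (exp (t * x))"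
      by (rule tendsto_eventually)
  qed simp
  from LIMSEQ_unique[OF this 1] show ?thesis by (simp add: mgf_def)
qed

text \<open>Moving the mass of \<open>[-1/n, 1/n]\<close> to the point \<open>1/n\<close> leaves measures without mass near \<open>0\<close>.
  This treats the Gaussian atom and the small jumps alike: both kernels are bounded on the
  unit interval and continuous at \<open>0\<close>, so the exponents converge by dominated convergence.\<close>

lemma kolmogorov_law_in_unit_interval:
  assumes fin: "finite_measure H" and sets[measurable_cong]: "sets H = sets borel"
    and bdd: "AE x in H. \<bar>x\<bar> \<le> 1"
  shows "\<exists>P. kolmogorov_law P H"
proof -
  interpret H: finite_measure H by fact
  (* The mass near 0 has to go to a nonzero point: the compound Poisson construction needs jumps
     of size bounded away from 0. *)
  define f where "f = (\<lambda>n x::real. if \<bar>x\<bar> \<le> 1 / real (Suc n) then 1 / real (Suc n) else x)"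
  have [measurable]: "f n \<in> borel_measurable borel" for n unfolding f_def by measurable
  define Hn where "Hn = (\<lambda>n. distr H borel (f n))"
  have "\<exists>P. kolmogorov_law P (Hn n)" for n
  proof (rule kolmogorov_law_away_from_0)
    show "finite_measure (Hn n)" unfolding Hn_def by (rule H.finite_measure_distr) simp
    show "AE x in Hn n. 1 / real (Suc n) \<le> \<bar>x\<bar>"
      unfolding Hn_def by (subst AE_distr_iff) (auto simp: f_def)
  qed (simp_all add: Hn_def)
  then obtain P where P: "\<And>n. kolmogorov_law (P n) (Hn n)" by metis
  have rdP: "real_distribution (P n)" for n using P unfolding kolmogorov_law_def by blast
  have charP: "char (P n) u = exp (CLINT x|H. lk_kernel u (f n x))" for n u
    using P[of n] unfolding kolmogorov_law_def Hn_def by (simp add: integral_distr)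
  have f1: "AE x in H. \<bar>f n x\<bar> \<le> 1" for n
    using bdd by eventually_elim (auto simp: f_def)
  have kle: "exp_kernel t x \<le> t\<^sup>2 / 2 * exp \<bar>t\<bar>" if "\<bar>x\<bar> \<le> 1" for t x
  proof -
    have "\<bar>t * x\<bar> \<le> \<bar>t\<bar>" using that by (simp add: abs_mult mult_left_le)
    then have "t\<^sup>2 / 2 * exp \<bar>t * x\<bar> \<le> t\<^sup>2 / 2 * exp \<bar>t\<bar>"
      by (intro mult_left_mono) auto
    then show ?thesis using exp_kernel_le[of t x] by linarith
  qed
  have bk: "AE x in H. norm (exp_kernel t (f n x)) \<le> t\<^sup>2 / 2 * exp \<bar>t\<bar>" for n t
    using f1[of n] by eventually_elim (simp only: real_norm_def abs_of_nonneg[OF exp_kernel_nonneg] kle)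
  have ik: "integrable H (\<lambda>x. exp_kernel t (f n x))" for n t
    by (rule H.integrable_const_bound[OF bk]) simp
  define K where "K = (\<lambda>t n. LINT x|H. exp_kernel t (f n x))"
  have K0: "0 \<le> K t n" for t n unfolding K_def by (rule integral_nonneg_AE) (simp add: exp_kernel_nonneg)
  have mgfP: "mgf (P n) t = ennreal (exp (K t n))" for n t
  proof -
    have "mgf (P n) t = exp_ennreal (\<integral>\<^sup>+x. ennreal (exp_kernel t (f n x)) \<partial>H)"
      using P[of n] unfolding kolmogorov_law_def Hn_def by (simp add: nn_integral_distr)
    also have "(\<integral>\<^sup>+x. ennreal (exp_kernel t (f n x)) \<partial>H) = ennreal (K t n)"
      unfolding K_def by (rule nn_integral_eq_integral[OF ik]) (simp add: exp_kernel_nonneg)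
    finally show ?thesis using K0 by simp
  qed
  have inv0: "(\<lambda>n. 1 / real (Suc n)) \<longlonglongrightarrow> 0" by (rule LIMSEQ_Suc[OF lim_1_over_n])
  have fx: "(\<lambda>n. g (f n x)) \<longlonglongrightarrow> g x" if "(g \<longlongrightarrow> g 0) (at 0)" for x and g :: "real \<Rightarrow> 'b::topological_space"
  proof (cases "x = 0")
    case True
    have "filterlim (\<lambda>n. 1 / real (Suc n)) (at 0) sequentially"
      unfolding filterlim_at using inv0 by auto
    from filterlim_compose[OF that this] show ?thesis using True by (simp add: f_def)
  next
    case False
    have "eventually (\<lambda>n. 1 / real (Suc n) < \<bar>x\<bar>) sequentially"
      using inv0 False by (intro order_tendstoD(2)) auto
    then have "eventually (\<lambda>n. g (f n x) = g x) sequentially"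
      by eventually_elim (simp add: f_def)
    then show ?thesis by (rule tendsto_eventually)
  qed
  define B where "B = (\<lambda>t. exp (t\<^sup>2 / 2 * exp \<bar>t\<bar> * measure H (space H)))"
  have KB: "exp (K t n) \<le> B t" for t n
  proof -
    have "K t n \<le> (LINT x|H. t\<^sup>2 / 2 * exp \<bar>t\<bar>)"
      unfolding K_def
      by (rule integral_mono_AE[OF ik]) (use bk[of t n] in \<open>auto elim!: eventually_mono\<close>)
    then show ?thesis by (simp add: B_def mult_ac)
  qed
  have "tight P"
  proof (rule tight_of_mgf_bound[OF rdP])
    show "mgf (P n) 1 \<le> ennreal (B 1)" "mgf (P n) (- 1) \<le> ennreal (B 1)" for n
      using KB[of 1 n] KB[of "-1" n] unfolding mgfP by (auto intro!: ennreal_leI simp: B_def)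
  qed
  then obtain r P' where r: "strict_mono (r :: nat \<Rightarrow> nat)" and P': "real_distribution P'"
    and conv: "weak_conv_m (P \<circ> id \<circ> r) P'"
    using tight_imp_convergent_subsubsequence[of P id] by (auto simp: strict_mono_id)
  have conv: "weak_conv_m (\<lambda>n. P (r n)) P'" using conv by (simp add: comp_def)
  have "char P' u = exp (CLINT x|H. lk_kernel u x)" for u
  proof -
    have "(\<lambda>n. CLINT x|H. lk_kernel u (f n x)) \<longlonglongrightarrow> (CLINT x|H. lk_kernel u x)"
    proof (rule integral_dominated_convergence[where w="\<lambda>_. u\<^sup>2 / 2"])
      show "AE x in H. (\<lambda>n. lk_kernel u (f n x)) \<longlonglongrightarrow> lk_kernel u x"
        by (simp add: fx lk_kernel_tendsto_0)
      show "AE x in H. norm (lk_kernel u (f n x)) \<le> u\<^sup>2 / 2" for n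
        by (rule AE_I2) (rule norm_lk_kernel_le)
    qed simp_all
    then have "(\<lambda>n. char (P (r n)) u) \<longlonglongrightarrow> exp (CLINT x|H. lk_kernel u x)"
      unfolding charP by (intro tendsto_exp) (rule LIMSEQ_subseq_LIMSEQ[OF _ r, unfolded comp_def])
    with levy_continuity1[OF rdP P' conv] show ?thesis by (rule LIMSEQ_unique)
  qed
  moreover have "mgf P' t = exp_ennreal (\<integral>\<^sup>+x. ennreal (exp_kernel t x) \<partial>H)" for t
  proof -
    have bk': "AE x in H. norm (exp_kernel t x) \<le> t\<^sup>2 / 2 * exp \<bar>t\<bar>"
      using bdd by eventually_elim (simp only: real_norm_def abs_of_nonneg[OF exp_kernel_nonneg] kle)
    have ik': "integrable H (exp_kernel t)"
      by (rule H.integrable_const_bound[OF bk']) simp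
    have "K t \<longlonglongrightarrow> (LINT x|H. exp_kernel t x)"
      unfolding K_def
    proof (rule integral_dominated_convergence[where w="\<lambda>_. t\<^sup>2 / 2 * exp \<bar>t\<bar>"])
      show "AE x in H. (\<lambda>n. exp_kernel t (f n x)) \<longlonglongrightarrow> exp_kernel t x"
        by (simp add: fx exp_kernel_tendsto_0)
    qed (use bk in simp_all)
    then have lim: "(\<lambda>n. exp (K t (r n))) \<longlonglongrightarrow> exp (LINT x|H. exp_kernel t x)"
      by (intro tendsto_exp) (rule LIMSEQ_subseq_LIMSEQ[OF _ r, unfolded comp_def])
    have "mgf P' t = ennreal (exp (LINT x|H. exp_kernel t x))"
    proof (rule mgf_weak_limit[OF rdP P' conv mgfP _ lim, of "B (2 * t)"])
      show "mgf (P (r n)) (2 * t) \<le> ennreal (B (2 * t))" for n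
        unfolding mgfP by (intro ennreal_leI KB)
    qed (simp_all add: B_def)
    also have "\<dots> = exp_ennreal (ennreal (LINT x|H. exp_kernel t x))"
      by (simp add: exp_kernel_nonneg)
    also have "ennreal (LINT x|H. exp_kernel t x) = (\<integral>\<^sup>+x. ennreal (exp_kernel t x) \<partial>H)"
      by (rule nn_integral_eq_integral[symmetric, OF ik']) (simp add: exp_kernel_nonneg)
    finally show ?thesis .
  qed
  ultimately have "kolmogorov_law P' H"
    using P' by (simp add: kolmogorov_law_def)
  then show ?thesis ..
qed

text \<open>Large jumps may make the moment generating function infinite, but they form a compound Poisson
  law, for which the formula is exact; only the bounded part needs a limit.\<close>

theorem kolmogorov_law_exists:
  assumes fin: "finite_measure H" and sets[measurable_cong]: "sets H = sets borel"
  shows "\<exists>P. kolmogorov_law P H"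
proof -
  interpret H: finite_measure H by fact
  define S where "S = {x::real. \<bar>x\<bar> \<le> 1}"
  have S[measurable]: "S \<in> sets borel" unfolding S_def by measurable
  define H1 where "H1 = density H (indicator S)"
  define H2 where "H2 = density H (indicator (- S))"
  have fin': "finite_measure (density H (indicator A))" if "A \<in> sets borel" for A
  proof
    have "emeasure (density H (indicator A)) (space (density H (indicator A))) = emeasure H A"
      using that by (subst emeasure_density) (auto simp: sets_eq_imp_space_eq[OF sets] intro!: nn_integral_cong)
    then show "emeasure (density H (indicator A)) (space (density H (indicator A))) \<noteq> \<infinity>" by simp
  qed
  have "\<exists>P. kolmogorov_law P H1"
    unfolding H1_def
    by (rule kolmogorov_law_in_unit_interval[OF fin'[OF S]]) (auto simp: sets AE_density S_def indicator_def)
  then obtain P1 where P1: "kolmogorov_law P1 H1" ..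
  have "\<exists>P. kolmogorov_law P H2"
    unfolding H2_def
    by (rule kolmogorov_law_away_from_0[OF fin', of _ 1]) (auto simp: sets AE_density S_def indicator_def)
  then obtain P2 where P2: "kolmogorov_law P2 H2" ..
  have "kolmogorov_law (P1 \<star> P2) H"
    unfolding kolmogorov_law_def
  proof (intro conjI allI)
    show "real_distribution (P1 \<star> P2)"
      using P1 P2 by (simp add: kolmogorov_law_def real_distribution_convolution)
    fix t :: real
    have i: "integrable H (\<lambda>x. indicator A x *\<^sub>R lk_kernel t x)" if "A \<in> sets borel" for A
      using that by (intro integrable_mult_indicator integrable_lk_kernel fin sets) (simp add: sets)
    have d: "density H (indicator A) = density H (\<lambda>x. ennreal (indicator A x))" for A
      by (simp add: ennreal_indicator)
    have "(CLINT x|H. lk_kernel t x) = (CLINT x|H. indicator S x *\<^sub>R lk_kernel t x + indicator (- S) x *\<^sub>R lk_kernel t x)"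
      by (intro Bochner_Integration.integral_cong) (auto simp: indicator_def)
    also have "\<dots> = (CLINT x|H1. lk_kernel t x) + (CLINT x|H2. lk_kernel t x)"
      unfolding H1_def H2_def d by (simp add: i integral_density)
    finally have "exp (CLINT x|H. lk_kernel t x) = char P1 t * char P2 t"
      using P1 P2 by (simp add: kolmogorov_law_def exp_add)
    then show "char (P1 \<star> P2) t = exp (CLINT x|H. lk_kernel t x)"
      using P1 P2 by (simp add: kolmogorov_law_def char_convolution)
    have "(\<integral>\<^sup>+x. ennreal (exp_kernel t x) \<partial>H) =
        (\<integral>\<^sup>+x. indicator S x * ennreal (exp_kernel t x) + indicator (- S) x * ennreal (exp_kernel t x) \<partial>H)"
      by (intro nn_integral_cong) (auto simp: indicator_def)
    also have "\<dots> = (\<integral>\<^sup>+x. ennreal (exp_kernel t x) \<partial>H1) + (\<integral>\<^sup>+x. ennreal (exp_kernel t x) \<partial>H2)"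
      unfolding H1_def H2_def by (simp add: nn_integral_density nn_integral_add)
    finally have "exp_ennreal (\<integral>\<^sup>+x. ennreal (exp_kernel t x) \<partial>H) = mgf P1 t * mgf P2 t"
      using P1 P2 by (simp add: kolmogorov_law_def exp_ennreal_add)
    then show "mgf (P1 \<star> P2) t = exp_ennreal (\<integral>\<^sup>+x. ennreal (exp_kernel t x) \<partial>H)"
      using P1 P2 by (simp add: kolmogorov_law_def mgf_convolution)
  qed
  then show ?thesis ..
qed

section \<open>The measure H and the law of R\<close>

lemma borel_measurable_of_sets_eq:
  assumes "sets \<nu> = sets borel" shows "f \<in> borel_measurable borel \<Longrightarrow> f \<in> borel_measurable \<nu>"
  using measurable_cong_sets[OF assms refl] by blast

text \<open>Integrals against \<open>H\<close> are evaluated by splitting off the atom at \<open>0\<close>; on the rest \<open>H\<close> has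
  density \<open>x\<^sup>2\<close> with respect to \<open>\<nu>\<close>.\<close>

lemma levy_H_off_0:
  assumes \<nu>: "sets \<nu> = sets borel"
  shows "density (levy_H a \<nu>) (indicator (-{0})) = density \<nu> (\<lambda>x. ennreal (x\<^sup>2))"
proof (rule measure_eqI)
  fix A assume "A \<in> sets (density (levy_H a \<nu>) (indicator (-{0})))"
  then have A[measurable]: "A \<in> sets borel" by simp
  note [measurable_cong] = \<nu>
  have "emeasure (density (levy_H a \<nu>) (indicator (-{0}))) A = emeasure (levy_H a \<nu>) (A - {0})"
    by (subst emeasure_density) (auto simp: indicator_inter_arith[symmetric] Diff_eq Int_commute)
  also have "\<dots> = (\<integral>\<^sup>+x. ennreal (x\<^sup>2) * indicator (A - {0}) x \<partial>\<nu>)"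
    by (subst emeasure_levy_H[OF \<nu>]) auto
  also have "\<dots> = (\<integral>\<^sup>+x. ennreal (x\<^sup>2) * indicator A x \<partial>\<nu>)"
    by (intro nn_integral_cong) (auto simp: indicator_def)
  also have "\<dots> = emeasure (density \<nu> (\<lambda>x. ennreal (x\<^sup>2))) A"
    by (subst emeasure_density) (auto simp: \<nu>)
  finally show "emeasure (density (levy_H a \<nu>) (indicator (-{0}))) A =
      emeasure (density \<nu> (\<lambda>x. ennreal (x\<^sup>2))) A" .
qed (simp add: \<nu>)

lemma emeasure_levy_H_0:
  assumes "sets \<nu> = sets borel"
  shows "emeasure (levy_H a \<nu>) {0} = ennreal a"
proof -
  have "(\<integral>\<^sup>+x. ennreal (x\<^sup>2) * indicator {0} x \<partial>\<nu>) = (\<integral>\<^sup>+x. 0 \<partial>\<nu>)"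
    by (intro nn_integral_cong) (auto simp: indicator_def)
  then show ?thesis by (subst emeasure_levy_H[OF assms]) simp_all
qed

lemma nn_integral_levy_H:
  assumes \<nu>: "sets \<nu> = sets borel" and f[measurable]: "f \<in> borel_measurable borel"
  shows "(\<integral>\<^sup>+x. f x \<partial>levy_H a \<nu>) = ennreal a * f 0 + (\<integral>\<^sup>+x. ennreal (x\<^sup>2) * f x \<partial>\<nu>)"
proof -
  note [measurable_cong] = \<nu>
  have "(\<integral>\<^sup>+x. f x \<partial>levy_H a \<nu>) =
      (\<integral>\<^sup>+x. f 0 * indicator {0} x + indicator (-{0}) x * f x \<partial>levy_H a \<nu>)"
    by (intro nn_integral_cong) (auto simp: indicator_def)
  also have "\<dots> = f 0 * emeasure (levy_H a \<nu>) {0} + (\<integral>\<^sup>+x. f x \<partial>density (levy_H a \<nu>) (indicator (-{0})))"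
    by (simp add: nn_integral_add nn_integral_cmult nn_integral_density)
  also have "(\<integral>\<^sup>+x. f x \<partial>density (levy_H a \<nu>) (indicator (-{0}))) = (\<integral>\<^sup>+x. ennreal (x\<^sup>2) * f x \<partial>\<nu>)"
    unfolding levy_H_off_0[OF \<nu>] by (simp add: nn_integral_density)
  finally show ?thesis by (simp add: emeasure_levy_H_0[OF \<nu>] mult.commute)
qed

lemma integrable_levy_H_iff:
  fixes f :: "real \<Rightarrow> 'b::{banach, second_countable_topology}"
  assumes \<nu>: "sets \<nu> = sets borel" and f: "f \<in> borel_measurable borel"
  shows "integrable (levy_H a \<nu>) f \<longleftrightarrow> integrable \<nu> (\<lambda>x. x\<^sup>2 *\<^sub>R f x)"
proof -
  have m: "f \<in> borel_measurable \<nu>" "(\<lambda>x. x\<^sup>2 *\<^sub>R f x) \<in> borel_measurable \<nu>"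
    using f by (auto intro!: borel_measurable_of_sets_eq[OF \<nu>])
  have "(\<integral>\<^sup>+x. ennreal (norm (f x)) \<partial>levy_H a \<nu>) =
      ennreal a * ennreal (norm (f 0)) + (\<integral>\<^sup>+x. ennreal (norm (x\<^sup>2 *\<^sub>R f x)) \<partial>\<nu>)"
    using f by (subst nn_integral_levy_H[OF \<nu>]) (simp_all add: ennreal_mult)
  then show ?thesis
    using f m by (simp add: integrable_iff_bounded ennreal_mult_less_top)
qed

lemma integral_levy_H:
  fixes f :: "real \<Rightarrow> 'b::{banach, second_countable_topology}"
  assumes \<nu>: "sets \<nu> = sets borel" and a: "0 \<le> a" and f: "integrable (levy_H a \<nu>) f"
  shows "integral\<^sup>L (levy_H a \<nu>) f = a *\<^sub>R f 0 + (\<integral>x. x\<^sup>2 *\<^sub>R f x \<partial>\<nu>)"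
proof -
  let ?H = "levy_H a \<nu>"
  have fm: "f \<in> borel_measurable borel"
    using borel_measurable_integrable[OF f] measurable_cong_sets[OF sets_levy_H refl] by blast
  have i0: "integrable ?H (\<lambda>x. indicator {0} x *\<^sub>R f 0)"
    by (intro integrable_scaleR_left integrable_real_indicator) (simp_all add: emeasure_levy_H_0[OF \<nu>])
  have i1: "integrable ?H (\<lambda>x. indicator (-{0}) x *\<^sub>R f x)"
    using f by (intro integrable_mult_indicator) auto
  have "integral\<^sup>L ?H f = (\<integral>x. indicator {0} x *\<^sub>R f 0 + indicator (-{0}) x *\<^sub>R f x \<partial>?H)"
    by (intro Bochner_Integration.integral_cong) (auto simp: indicator_def)
  also have "\<dots> = measure ?H {0} *\<^sub>R f 0 + (\<integral>x. indicator (-{0}) x *\<^sub>R f x \<partial>?H)"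
    by (subst Bochner_Integration.integral_add[OF i0 i1])
       (simp add: emeasure_levy_H_0[OF \<nu>] sets_eq_imp_space_eq[OF sets_levy_H])
  also have "(\<integral>x. indicator (-{0}) x *\<^sub>R f x \<partial>?H) = integral\<^sup>L (density ?H (\<lambda>x. ennreal (indicator (-{0}) x))) f"
    using fm by (subst integral_density) auto
  also have "\<dots> = integral\<^sup>L (density \<nu> (\<lambda>x. ennreal (x\<^sup>2))) f"
    by (simp add: ennreal_indicator levy_H_off_0[OF \<nu>])
  also have "\<dots> = (\<integral>x. x\<^sup>2 *\<^sub>R f x \<partial>\<nu>)"
    using fm by (intro integral_density) (auto intro!: borel_measurable_of_sets_eq[OF \<nu>])
  finally show ?thesis using a by (simp add: measure_def emeasure_levy_H_0[OF \<nu>])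
qed

text \<open>Expectations under the Beta law by the fundamental theorem of calculus, given an antiderivative
  of \<open>2 (1 - b) g b\<close>.\<close>

lemma nn_integral_beta12:
  assumes "\<And>b. b \<in> {0..1} \<Longrightarrow> (G has_real_derivative 2 * (1 - b) * g b) (at b)"
    and g[measurable]: "g \<in> borel_measurable borel" and g0: "\<And>b. b \<in> {0..1} \<Longrightarrow> 0 \<le> g b"
  shows "(\<integral>\<^sup>+b. ennreal (g b) \<partial>beta12) = ennreal (G 1 - G 0)"
proof -
  have "(\<integral>\<^sup>+b. ennreal (g b) \<partial>beta12) =
      (\<integral>\<^sup>+b. ennreal (2 * (1 - b)) * indicator {0<..<1} b * ennreal (g b) \<partial>lborel)"
    unfolding beta12_def by (subst nn_integral_density) auto
  also have "\<dots> = (\<integral>\<^sup>+b. ennreal (2 * (1 - b) * g b) * indicator {0..1} b \<partial>lborel)"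
  proof (rule nn_integral_cong_AE)
    have "AE b in lborel. b \<noteq> 0 \<and> b \<noteq> (1::real)"
      using AE_lborel_singleton[of 0] AE_lborel_singleton[of 1] by eventually_elim simp
    then show "AE b in lborel. ennreal (2 * (1 - b)) * indicator {0<..<1} b * ennreal (g b) =
        ennreal (2 * (1 - b) * g b) * indicator {0..1} b"
      by eventually_elim (auto simp: indicator_def ennreal_mult g0)
  qed
  also have "\<dots> = ennreal (G 1 - G 0)"
    by (rule nn_integral_FTC_Icc) (use assms in auto)
  finally show ?thesis .
qed

lemma sets_beta12 [simp, measurable_cong]: "sets beta12 = sets borel"
  by (simp add: beta12_def)

lemma space_beta12 [simp]: "space beta12 = UNIV"
  by (simp add: beta12_def)

lemma prob_space_beta12: "prob_space beta12"
proof
  have "(\<integral>\<^sup>+b. ennreal 1 \<partial>beta12) = ennreal ((2 * 1 - 1\<^sup>2) - (2 * 0 - 0\<^sup>2))"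
    by (rule nn_integral_beta12) (auto intro!: derivative_eq_intros)
  then show "emeasure beta12 (space beta12) = 1" by simp
qed

lemma AE_beta12: "AE b in beta12. 0 < b \<and> b < 1"
  unfolding beta12_def by (subst AE_density) (auto simp: indicator_def)

lemma integral_beta12_id: "integrable beta12 (\<lambda>b. b)" "(LINT b|beta12. b) = 1 / 3"
proof -
  interpret prob_space beta12 by (rule prob_space_beta12)
  show i: "integrable beta12 (\<lambda>b. b)"
    by (rule integrable_const_bound[where B=1]) (use AE_beta12 in \<open>auto elim: eventually_mono\<close>)
  have n: "AE b in beta12. 0 \<le> b" using AE_beta12 by eventually_elim simp
  have "(\<integral>\<^sup>+b. ennreal b \<partial>beta12) = ennreal ((1\<^sup>2 - 2 * 1^3 / 3) - (0\<^sup>2 - 2 * 0^3 / 3))"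
    by (rule nn_integral_beta12) (auto intro!: derivative_eq_intros simp: algebra_simps power2_eq_square)
  then show "(LINT b|beta12. b) = 1 / 3"
    using nn_integral_eq_integral[OF i n] integral_nonneg_AE[OF n] by simp
qed

lemma integral_beta12_square: "integrable beta12 (\<lambda>b. b\<^sup>2)" "(LINT b|beta12. b\<^sup>2) = 1 / 6"
proof -
  interpret prob_space beta12 by (rule prob_space_beta12)
  show i: "integrable beta12 (\<lambda>b. b\<^sup>2)"
  proof (rule integrable_const_bound[where B=1])
    show "AE b in beta12. norm (b\<^sup>2) \<le> 1"
      using AE_beta12 by eventually_elim (simp add: power_le_one)
  qed simp
  have "(\<integral>\<^sup>+b. ennreal (b\<^sup>2) \<partial>beta12) = ennreal ((2 * 1^3 / 3 - 1^4 / 2) - (2 * 0^3 / 3 - 0^4 / 2))"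
    by (rule nn_integral_beta12)
       (auto intro!: derivative_eq_intros simp: algebra_simps power2_eq_square power3_eq_cube)
  then have "ennreal (LINT b|beta12. b\<^sup>2) = ennreal (1 / 6)"
    using nn_integral_eq_integral[OF i] by simp
  then show "(LINT b|beta12. b\<^sup>2) = 1 / 6" by (subst (asm) ennreal_inj) auto
qed

text \<open>Taylor's formula with integral remainder; this identity is the reason for the Beta(1,2) factor
  in \<open>R\<close>.\<close>

lemma nn_integral_beta12_exp:
  assumes "t \<noteq> 0"
  shows "(\<integral>\<^sup>+b. ennreal (exp (t * (b * z))) \<partial>beta12) = ennreal (2 / t\<^sup>2 * exp_kernel t z)"
proof (cases "z = 0")
  case True
  then show ?thesis
    using assms prob_space.emeasure_space_1[OF prob_space_beta12] by (simp add: exp_kernel_def)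
next
  case False
  define y where "y = t * z"
  have y: "y \<noteq> 0" using False assms by (simp add: y_def)
  define G where "G = (\<lambda>b. 2 * (1 - b) * exp (b * y) / y + 2 * exp (b * y) / y\<^sup>2)"
  have "(\<integral>\<^sup>+b. ennreal (exp (b * y)) \<partial>beta12) = ennreal (G 1 - G 0)"
  proof (rule nn_integral_beta12)
    fix b :: real
    show "(G has_real_derivative 2 * (1 - b) * exp (b * y)) (at b)"
      unfolding G_def using y
      by (auto intro!: derivative_eq_intros simp: power2_eq_square field_simps)
  qed auto
  also have "G 1 - G 0 = 2 / t\<^sup>2 * exp_kernel t z"
    using False assms by (simp add: G_def exp_kernel_def y_def field_simps power2_eq_square)
  finally show ?thesis by (simp add: y_def ac_simps)
qed

text \<open>The total mass assumption makes \<open>Z\<close> a probability law, namely that of the second factor of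
  \<open>R = B Z\<close>.\<close>

locale levy_size_bias =
  fixes V a :: real and \<nu> :: "real measure"
  assumes V: "0 < V" and levy_sets: "sets \<nu> = sets borel"
    and mass: "emeasure (levy_H a \<nu>) UNIV = ennreal V"
begin

abbreviation H :: "real measure" where "H \<equiv> levy_H a \<nu>"
definition Z :: "real measure" where "Z = scale_measure (ennreal (1 / V)) H"
abbreviation \<rho> :: "real measure" where "\<rho> \<equiv> law_R V a \<nu>"

lemma space_H [simp]: "space H = UNIV"
  using sets_eq_imp_space_eq[OF sets_levy_H] by simp

lemma finite_H: "finite_measure H"
  by standard (simp add: mass)

lemma sets_Z [simp, measurable_cong]: "sets Z = sets borel"
  by (simp add: Z_def)

lemma prob_Z: "prob_space Z"
  by standard (use V in \<open>simp add: Z_def space_scale_measure mass ennreal_mult[symmetric]\<close>)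

lemma Z_eq: "Z = density H (\<lambda>_. ennreal (1 / V))"
  by (rule measure_eqI) (simp_all add: Z_def emeasure_density nn_integral_cmult)

lemma law_R_eq: "\<rho> = distr (beta12 \<Otimes>\<^sub>M Z) borel (\<lambda>p. fst p * snd p)"
  by (simp add: law_R_def Z_def case_prod_beta')

lemma real_distribution_law_R: "real_distribution \<rho>"
proof -
  interpret B: prob_space beta12 by (rule prob_space_beta12)
  interpret Z: prob_space Z by (rule prob_Z)
  interpret BZ: pair_prob_space beta12 Z ..
  show ?thesis unfolding law_R_eq
    by (intro borel_real_distribution BZ.prob_space_distr) auto
qed

text \<open>Both sides may be infinite, which is why the identity is stated for nonnegative integrals.\<close>

lemma mgf_law_R:
  assumes "t \<noteq> 0"
  shows "(\<integral>\<^sup>+x. ennreal (exp_kernel t x) \<partial>H) = ennreal (V * t\<^sup>2 / 2) * mgf \<rho> t"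
proof -
  interpret B: prob_space beta12 by (rule prob_space_beta12)
  interpret Z: prob_space Z by (rule prob_Z)
  interpret BZ: pair_prob_space beta12 Z ..
  have "mgf \<rho> t = (\<integral>\<^sup>+p. ennreal (exp (t * (fst p * snd p))) \<partial>(beta12 \<Otimes>\<^sub>M Z))"
    unfolding mgf_def law_R_eq by (subst nn_integral_distr) auto
  also have "\<dots> = (\<integral>\<^sup>+z. \<integral>\<^sup>+b. ennreal (exp (t * (b * z))) \<partial>beta12 \<partial>Z)"
    by (subst BZ.nn_integral_snd[symmetric]) (auto simp: case_prod_beta)
  also have "\<dots> = (\<integral>\<^sup>+z. ennreal (2 / t\<^sup>2 * exp_kernel t z) \<partial>Z)"
    by (simp only: nn_integral_beta12_exp[OF assms])
  also have "\<dots> = (\<integral>\<^sup>+z. ennreal (2 / (V * t\<^sup>2)) * ennreal (exp_kernel t z) \<partial>H)"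
    unfolding Z_eq using V
    by (subst nn_integral_density)
       (auto intro!: nn_integral_cong simp: ennreal_mult[symmetric] exp_kernel_nonneg)
  also have "\<dots> = ennreal (2 / (V * t\<^sup>2)) * (\<integral>\<^sup>+z. ennreal (exp_kernel t z) \<partial>H)"
    by (rule nn_integral_cmult) simp
  finally have "ennreal (V * t\<^sup>2 / 2) * mgf \<rho> t =
      ennreal (V * t\<^sup>2 / 2) * ennreal (2 / (V * t\<^sup>2)) * (\<integral>\<^sup>+z. ennreal (exp_kernel t z) \<partial>H)"
    by (simp add: mult.assoc)
  also have "ennreal (V * t\<^sup>2 / 2) * ennreal (2 / (V * t\<^sup>2)) = 1"
    using V assms by (simp add: ennreal_mult[symmetric])
  finally show ?thesis by simp
qed

lemma law_R_moment:
  assumes b: "integrable beta12 (\<lambda>b. b ^ n)" and z: "integrable H (\<lambda>z. z ^ n)"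
  shows "integrable \<rho> (\<lambda>r. r ^ n)"
    "(LINT r|\<rho>. r ^ n) = (LINT b|beta12. b ^ n) * (LINT z|H. z ^ n) / V"
proof -
  interpret B: prob_space beta12 by (rule prob_space_beta12)
  interpret Z: prob_space Z by (rule prob_Z)
  interpret BZ: pair_prob_space beta12 Z ..
  have iZ: "integrable Z (\<lambda>z. z ^ n)"
    unfolding Z_eq using V z by (subst integrable_density) auto
  have eZ: "(LINT z|Z. z ^ n) = (LINT z|H. z ^ n) / V"
    unfolding Z_eq using V by (subst integral_density) (auto simp: divide_inverse mult.commute)
  have ip: "integrable (beta12 \<Otimes>\<^sub>M Z) (\<lambda>p. fst p ^ n * snd p ^ n)"
  proof (rule BZ.Fubini_integrable)
    show "integrable beta12 (\<lambda>x. LINT y|Z. norm (fst (x, y) ^ n * snd (x, y) ^ n))"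
      using integrable_norm[OF b] by (simp add: abs_mult)
    show "AE x in beta12. integrable Z (\<lambda>y. fst (x, y) ^ n * snd (x, y) ^ n)"
      using iZ by simp
  qed simp
  show "integrable \<rho> (\<lambda>r. r ^ n)"
    unfolding law_R_eq using ip by (subst integrable_distr_eq) (auto simp: power_mult_distrib)
  have "(LINT r|\<rho>. r ^ n) = (LINT p|(beta12 \<Otimes>\<^sub>M Z). fst p ^ n * snd p ^ n)"
    unfolding law_R_eq by (subst integral_distr) (auto simp: power_mult_distrib)
  also have "\<dots> = (LINT b|beta12. LINT z|Z. b ^ n * z ^ n)"
    using BZ.integral_fst'[OF ip] by simp
  finally show "(LINT r|\<rho>. r ^ n) = (LINT b|beta12. b ^ n) * (LINT z|H. z ^ n) / V"
    by (simp add: eZ)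
qed

end

section \<open>Derivatives of the exponent, drift, mass and cumulants\<close>

lemma has_vector_derivative_iff_quotient:
  "(f has_vector_derivative D) (at u) \<longleftrightarrow> ((\<lambda>h. (f (u + h) - f u) /\<^sub>R h) \<longlongrightarrow> D) (at 0)"
proof -
  have "eventually (\<lambda>h. norm (f (u + h) - f u - h *\<^sub>R D) / norm h = norm ((f (u + h) - f u) /\<^sub>R h - D)) (at 0)"
    unfolding eventually_at_filter
  proof (intro always_eventually allI impI)
    fix h :: real assume h: "h \<noteq> 0"
    then have "(f (u + h) - f u) /\<^sub>R h - D = (f (u + h) - f u - h *\<^sub>R D) /\<^sub>R h"
      by (simp add: scaleR_diff_right)
    then show "norm (f (u + h) - f u - h *\<^sub>R D) / norm h = norm ((f (u + h) - f u) /\<^sub>R h - D)"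
      by (simp add: divide_inverse mult.commute)
  qed
  then show ?thesis
    unfolding has_vector_derivative_def has_derivative_at
    by (simp add: bounded_linear_scaleR_left tendsto_cong tendsto_norm_zero_iff LIM_zero_iff)
qed

text \<open>Differentiation under the integral sign: a bound on the derivatives near \<open>u0\<close> dominates the
  difference quotients by the mean value inequality.\<close>

lemma has_vector_derivative_integral:
  fixes F :: "real \<Rightarrow> 'a \<Rightarrow> 'b::{banach, second_countable_topology}"
  assumes e: "0 < e"
    and int: "\<And>u. \<bar>u - u0\<bar> < e \<Longrightarrow> integrable N (F u)"
    and der: "\<And>u x. \<bar>u - u0\<bar> < e \<Longrightarrow> ((\<lambda>u. F u x) has_vector_derivative F' u x) (at u)"
    and bd: "\<And>u x. \<bar>u - u0\<bar> < e \<Longrightarrow> norm (F' u x) \<le> w x"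
    and w: "integrable N w" and m: "F' u0 \<in> borel_measurable N"
  shows "((\<lambda>u. \<integral>x. F u x \<partial>N) has_vector_derivative (\<integral>x. F' u0 x \<partial>N)) (at u0)"
  unfolding has_vector_derivative_iff_quotient tendsto_at_iff_sequentially
proof (intro allI impI)
  fix X :: "nat \<Rightarrow> real" assume X0: "\<forall>i. X i \<in> UNIV - {0}" and X: "X \<longlonglongrightarrow> 0"
  let ?q = "\<lambda>h x. (F (u0 + h) x - F u0 x) /\<^sub>R h"
  have "eventually (\<lambda>n. \<bar>X n\<bar> < e) sequentially"
    using tendstoD[OF X e] by simp
  then obtain k where k: "\<And>n. k \<le> n \<Longrightarrow> \<bar>X n\<bar> < e"
    unfolding eventually_sequentially by blast
  define Y where "Y = (\<lambda>n. X (n + k))"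
  have Y: "\<bar>Y n\<bar> < e" "Y n \<noteq> 0" for n using k[of "n + k"] X0 by (auto simp: Y_def)
  have Ylim: "Y \<longlonglongrightarrow> 0" unfolding Y_def using X by (rule LIMSEQ_ignore_initial_segment)
  have iu: "integrable N (F (u0 + Y n))" "integrable N (F u0)" for n
    using int[of "u0 + Y n"] int[of u0] Y[of n] e by simp_all
  have "(\<lambda>n. \<integral>x. ?q (Y n) x \<partial>N) \<longlonglongrightarrow> (\<integral>x. F' u0 x \<partial>N)"
  proof (rule integral_dominated_convergence[OF m _ w])
    show "?q (Y n) \<in> borel_measurable N" for n
      using borel_measurable_integrable[OF iu(1)] borel_measurable_integrable[OF iu(2)] by measurable
    show "AE x in N. (\<lambda>n. ?q (Y n) x) \<longlonglongrightarrow> F' u0 x"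
    proof (rule AE_I2)
      fix x
      have "((\<lambda>h. ?q h x) \<longlongrightarrow> F' u0 x) (at 0)"
        using der[of u0 x] e by (simp add: has_vector_derivative_iff_quotient)
      moreover have "filterlim Y (at 0) sequentially"
        unfolding filterlim_at using Ylim Y by simp
      ultimately show "(\<lambda>n. ?q (Y n) x) \<longlonglongrightarrow> F' u0 x"
        by (rule filterlim_compose)
    qed
    show "AE x in N. norm (?q (Y n) x) \<le> w x" for n
    proof (rule AE_I2)
      fix x
      have "norm (F (u0 + Y n) x - F u0 x) \<le> w x * norm (u0 + Y n - u0)"
      proof (rule differentiable_bound[where S="ball u0 e" and f'="\<lambda>u h. h *\<^sub>R F' u x"])
        fix u assume "u \<in> ball u0 e"
        then have u: "\<bar>u - u0\<bar> < e" by (simp add: dist_real_def abs_minus_commute)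
        show "((\<lambda>u. F u x) has_derivative (\<lambda>h. h *\<^sub>R F' u x)) (at u within ball u0 e)"
          using der[OF u] unfolding has_vector_derivative_def by (rule has_derivative_at_withinI)
        show "onorm (\<lambda>h. h *\<^sub>R F' u x) \<le> w x"
        proof (rule onorm_le)
          show "norm (h *\<^sub>R F' u x) \<le> w x * norm h" for h :: real
            using mult_right_mono[OF bd[OF u, of x], of "norm h"] by (simp add: mult.commute)
        qed
      qed (use Y[of n] e in \<open>auto simp: dist_real_def\<close>)
      then show "norm (?q (Y n) x) \<le> w x"
        using Y(2)[of n] by (simp add: divide_inverse_commute[symmetric] pos_divide_le_eq)
    qed
  qed
  also have "(\<lambda>n. \<integral>x. ?q (Y n) x \<partial>N) =
      (\<lambda>n. ((\<integral>x. F (u0 + Y n) x \<partial>N) - (\<integral>x. F u0 x \<partial>N)) /\<^sub>R Y n)"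
    by (simp add: iu)
  finally show "((\<lambda>h. ((\<integral>x. F (u0 + h) x \<partial>N) - (\<integral>x. F u0 x \<partial>N)) /\<^sub>R h) \<circ> X) \<longlonglongrightarrow> (\<integral>x. F' u0 x \<partial>N)"
    unfolding Y_def comp_def by (rule LIMSEQ_offset)
qed

lemma has_vector_derivative_iexp_scaled:
  "((\<lambda>u. iexp (u * x)) has_vector_derivative \<i> * of_real x * iexp (u * x)) (at u)"
  unfolding of_real_mult
  by (rule has_vector_derivative_real_field[where f="\<lambda>z. exp (\<i> * (z * of_real x))"])
     (auto intro!: derivative_eq_intros)

lemma has_vector_derivative_fourier:
  fixes g :: "real \<Rightarrow> complex"
  assumes N: "sets N = sets borel" and g: "integrable N g" and xg: "integrable N (\<lambda>x. x *\<^sub>R g x)"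
  shows "((\<lambda>u. CLINT x|N. iexp (u * x) * g x) has_vector_derivative
      (CLINT x|N. iexp (u * x) * (\<i> * of_real x * g x))) (at u)"
proof (rule has_vector_derivative_integral[where e=1 and w="\<lambda>x. norm (x *\<^sub>R g x)"])
  note [measurable_cong] = N
  have [measurable]: "g \<in> borel_measurable N" using g by simp
  fix u x
  show "integrable N (\<lambda>x. iexp (u * x) * g x)"
    by (rule Bochner_Integration.integrable_bound[OF g]) (auto simp: norm_mult)
  show "((\<lambda>u. iexp (u * x) * g x) has_vector_derivative iexp (u * x) * (\<i> * of_real x * g x)) (at u)"
    by (rule has_vector_derivative_eq_rhs[OF has_vector_derivative_mult_left[OF has_vector_derivative_iexp_scaled]]) simp
  show "(\<lambda>x. iexp (u * x) * (\<i> * of_real x * g x)) \<in> borel_measurable N" for u by measurable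
qed (use integrable_norm[OF xg] in \<open>auto simp: norm_mult\<close>)

text \<open>The derivative of \<open>lk_kernel\<close> in its first argument.  One further derivative removes the
  denominator, so that the second derivative of the exponent is minus the Fourier transform
  of \<open>H\<close>.\<close>

definition lk_kernel' :: "real \<Rightarrow> real \<Rightarrow> complex" where
  "lk_kernel' u x = (if x = 0 then - of_real u else \<i> * (iexp (u * x) - 1) / of_real x)"

lemma norm_lk_kernel'_le: "norm (lk_kernel' u x) \<le> \<bar>u\<bar>"
proof (cases "x = 0")
  case False
  have "norm (iexp (u * x) - 1) \<le> \<bar>u * x\<bar>"
    using iexp_approx1[of "u * x" 0] by simp
  then show ?thesis
    using False by (simp add: lk_kernel'_def norm_divide norm_mult pos_divide_le_eq abs_mult)
qed (simp add: lk_kernel'_def)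

lemma measurable_lk_kernel' [measurable]: "lk_kernel' u \<in> borel_measurable borel"
  unfolding lk_kernel'_def[abs_def] by measurable

lemma lk_kernel_has_vector_derivative:
  "((\<lambda>u. lk_kernel u x) has_vector_derivative lk_kernel' u x) (at u)"
proof (cases "x = 0")
  case True
  show ?thesis
  proof -
    have "((\<lambda>u. - of_real (u\<^sup>2 / 2)) has_vector_derivative - complex_of_real u) (at u)"
      by (rule has_vector_derivative_minus[OF has_vector_derivative_of_real])
         (auto intro!: derivative_eq_intros)
    then show ?thesis using True by (simp only: lk_kernel_def lk_kernel'_def refl if_True)
  qed
next
  case False
  have "((\<lambda>u. (iexp (u * x) - 1 - \<i> * of_real (u * x)) / of_real (x\<^sup>2)) has_vector_derivative
      (\<i> * of_real x * iexp (u * x) - 0 - \<i> * of_real x) / of_real (x\<^sup>2)) (at u)"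
    by (intro has_vector_derivative_divide has_vector_derivative_diff has_vector_derivative_iexp_scaled
        has_vector_derivative_const has_vector_derivative_mult_right has_vector_derivative_of_real)
       (auto intro!: derivative_eq_intros)
  then show ?thesis
    using False by (simp add: lk_kernel_def lk_kernel'_def power2_eq_square right_diff_distrib diff_divide_distrib)
qed

lemma lk_kernel'_has_vector_derivative:
  "((\<lambda>u. lk_kernel' u x) has_vector_derivative - iexp (u * x)) (at u)"
proof (cases "x = 0")
  case True
  then show ?thesis
    using has_vector_derivative_minus[OF has_vector_derivative_of_real[of "\<lambda>u. u" 1 "at u"]]
    by (auto simp: lk_kernel'_def)
next
  case False
  have "((\<lambda>u. \<i> * (iexp (u * x) - 1) / of_real x) has_vector_derivative
      (\<i> * (\<i> * of_real x * iexp (u * x) - 0)) / of_real x) (at u)"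
    by (intro has_vector_derivative_divide has_vector_derivative_diff has_vector_derivative_iexp_scaled
        has_vector_derivative_const has_vector_derivative_mult_right)
  then show ?thesis
    using False by (simp add: lk_kernel'_def mult.assoc[symmetric])
qed

lemma lk_exponent_has_vector_derivative:
  assumes fin: "finite_measure H" and H: "sets H = sets borel"
  shows "((\<lambda>u. CLINT x|H. lk_kernel u x) has_vector_derivative (CLINT x|H. lk_kernel' u x)) (at u)"
proof (rule has_vector_derivative_integral[where e=1 and w="\<lambda>x. \<bar>u\<bar> + 1"])
  interpret finite_measure H by fact
  note [measurable_cong] = H
  show "integrable H (\<lambda>x. \<bar>u\<bar> + 1)" by simp
  show "lk_kernel' u \<in> borel_measurable H" by measurable
  fix v x :: real assume "\<bar>v - u\<bar> < 1"
  then show "norm (lk_kernel' v x) \<le> \<bar>u\<bar> + 1"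
    using norm_lk_kernel'_le[of v x] by linarith
qed (use integrable_lk_kernel[OF fin H] lk_kernel_has_vector_derivative in auto)

lemma lk_exponent'_has_vector_derivative:
  assumes fin: "finite_measure H" and H: "sets H = sets borel"
  shows "((\<lambda>u. CLINT x|H. lk_kernel' u x) has_vector_derivative - char H u) (at u)"
proof -
  interpret finite_measure H by fact
  note [measurable_cong] = H
  have "((\<lambda>u. CLINT x|H. lk_kernel' u x) has_vector_derivative (CLINT x|H. - iexp (u * x))) (at u)"
  proof (rule has_vector_derivative_integral[where e=1 and w="\<lambda>x. 1"])
    fix v x :: real
    show "integrable H (\<lambda>x. lk_kernel' v x)"
      by (rule integrable_const_bound[where B="\<bar>v\<bar>"]) (auto intro!: AE_I2 norm_lk_kernel'_le)
    show "(\<lambda>x. - iexp (u * x)) \<in> borel_measurable H" by measurable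
  qed (use lk_kernel'_has_vector_derivative in auto)
  then show ?thesis by (simp add: char_def)
qed

lemma char_has_vector_derivative:
  assumes "finite_measure N" "sets N = sets borel" and x: "integrable N (\<lambda>x. x)"
  shows "(char N has_vector_derivative (CLINT x|N. iexp (u * x) * (\<i> * of_real x))) (at u)"
proof -
  interpret finite_measure N by fact
  have "((\<lambda>u. CLINT x|N. iexp (u * x) * 1) has_vector_derivative
      (CLINT x|N. iexp (u * x) * (\<i> * of_real x * 1))) (at u)"
    by (rule has_vector_derivative_fourier[OF assms(2)]) (simp_all add: scaleR_conv_of_real x complex_of_real_integrable_eq)
  then show ?thesis by (simp add: char_def[abs_def])
qed

lemma char_has_vector_derivative2:
  assumes "finite_measure N" "sets N = sets borel" and x: "integrable N (\<lambda>x. x)"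
    and x2: "integrable N (\<lambda>x. x\<^sup>2)"
  shows "((\<lambda>u. CLINT x|N. iexp (u * x) * (\<i> * of_real x)) has_vector_derivative
      (CLINT x|N. iexp (u * x) * (- of_real (x\<^sup>2)))) (at u)"
proof -
  have "((\<lambda>u. CLINT x|N. iexp (u * x) * (\<i> * of_real x)) has_vector_derivative
      (CLINT x|N. iexp (u * x) * (\<i> * of_real x * (\<i> * of_real x)))) (at u)"
  proof (rule has_vector_derivative_fourier[OF assms(2)])
    show "complex_integrable N (\<lambda>x. \<i> * of_real x)"
      by (intro integrable_mult_right) (simp only: complex_of_real_integrable_eq x)
    have "complex_integrable N (\<lambda>x. \<i> * of_real (x\<^sup>2))"
      by (intro integrable_mult_right) (simp only: complex_of_real_integrable_eq x2)
    then show "complex_integrable N (\<lambda>x. x *\<^sub>R (\<i> * of_real x))"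
      by (simp add: scaleR_conv_of_real power2_eq_square mult.left_commute)
  qed
  also have "(\<lambda>x. iexp (u * x) * (\<i> * of_real x * (\<i> * of_real x))) = (\<lambda>x. iexp (u * x) * (- of_real (x\<^sup>2)))"
  proof
    fix x :: real
    have "\<i> * of_real x * (\<i> * of_real x) = (\<i> * \<i>) * (of_real x * of_real x :: complex)"
      by (simp only: mult.assoc mult.left_commute)
    then show "iexp (u * x) * (\<i> * of_real x * (\<i> * of_real x)) = iexp (u * x) * (- of_real (x\<^sup>2))"
      by (simp add: power2_eq_square)
  qed
  finally show ?thesis .
qed

lemma has_vector_derivative_exp_complex:
  fixes f :: "real \<Rightarrow> complex"
  assumes "(f has_vector_derivative D) (at u)"
  shows "((\<lambda>u. exp (f u)) has_vector_derivative D * exp (f u)) (at u)"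
  using field_vector_diff_chain_at[OF assms DERIV_exp] by (simp add: comp_def)

text \<open>Differentiating the characteristic function once and twice at \<open>0\<close>, from the moments and from
  the exponent.\<close>

lemma lk_drift_and_mass:
  assumes \<mu>: "real_distribution \<mu>" and x: "integrable \<mu> (\<lambda>x. x)" "(LINT x|\<mu>. x) = 0"
    and x2: "integrable \<mu> (\<lambda>x. x\<^sup>2)"
    and fin: "finite_measure H" and H: "sets H = sets borel"
    and char: "\<And>u. char \<mu> u = exp (\<i> * of_real (b * u) + (CLINT x|H. lk_kernel u x))"
  shows "b = 0" "measure H UNIV = (LINT x|\<mu>. x\<^sup>2)"
proof -
  interpret real_distribution \<mu> by fact
  let ?p1 = "\<lambda>u. CLINT x|H. lk_kernel' u x"
  have sH: "space H = UNIV" using sets_eq_imp_space_eq[OF H] by simp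
  have s\<mu>: "sets \<mu> = sets borel" by simp
  note d1 = char_has_vector_derivative[OF finite_measure_axioms s\<mu> x(1)]
  note d2 = char_has_vector_derivative2[OF finite_measure_axioms s\<mu> x(1) x2]
  have "(char \<mu> has_vector_derivative (\<i> * of_real b + ?p1 u) * char \<mu> u) (at u)" for u
  proof -
    have "((\<lambda>u. \<i> * of_real (b * u)) has_vector_derivative \<i> * of_real b) (at u)"
      by (intro has_vector_derivative_mult_right has_vector_derivative_of_real) (auto intro!: derivative_eq_intros)
    then have "((\<lambda>u. \<i> * of_real (b * u) + (CLINT x|H. lk_kernel u x)) has_vector_derivative
        \<i> * of_real b + ?p1 u) (at u)"
      by (intro has_vector_derivative_add lk_exponent_has_vector_derivative[OF fin H])
    from has_vector_derivative_exp_complex[OF this] show ?thesis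
      unfolding char[symmetric] .
  qed
  then have e1: "(CLINT x|\<mu>. iexp (u * x) * (\<i> * of_real x)) = (\<i> * of_real b + ?p1 u) * char \<mu> u" for u
    using d1 vector_derivative_unique_at by blast
  have p10: "?p1 0 = 0"
  proof -
    have "lk_kernel' 0 = (\<lambda>x. 0)" by (simp add: lk_kernel'_def fun_eq_iff)
    then show ?thesis by simp
  qed
  have "(CLINT x|\<mu>. \<i> * of_real x) = \<i> * of_real (LINT x|\<mu>. x)"
    by (simp only: integral_mult_right_zero integral_complex_of_real)
  then show b: "b = 0"
    using e1[of 0] p10 char_zero x(2) by simp
  have "((\<lambda>u. ?p1 u * char \<mu> u) has_vector_derivative
      ?p1 0 * (CLINT x|\<mu>. iexp (0 * x) * (\<i> * of_real x)) + - char H 0 * char \<mu> 0) (at 0)"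
    by (intro has_vector_derivative_mult lk_exponent'_has_vector_derivative fin H d1)
  moreover have "((\<lambda>u. ?p1 u * char \<mu> u) has_vector_derivative
      (CLINT x|\<mu>. iexp (0 * x) * (- of_real (x\<^sup>2)))) (at 0)"
    using d2[of 0] unfolding e1 by (simp add: b)
  ultimately have "(CLINT x|\<mu>. iexp (0 * x) * (- of_real (x\<^sup>2))) = - char H 0"
    using vector_derivative_unique_at p10 char_zero by fastforce
  moreover have "(CLINT x|\<mu>. iexp (0 * x) * (- of_real (x\<^sup>2))) = - of_real (LINT x|\<mu>. x\<^sup>2)"
    by (simp del: of_real_power)
  moreover have "char H 0 = of_real (measure H UNIV)"
    unfolding char_def by (simp add: sH scaleR_conv_of_real)
  ultimately show "measure H UNIV = (LINT x|\<mu>. x\<^sup>2)"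
    by (metis neg_equal_iff_equal of_real_eq_iff)
qed

lemma vector_derivative_on_open:
  assumes "open S" "u \<in> S" "\<And>v. v \<in> S \<Longrightarrow> f v = g v" "(g has_vector_derivative D) (at u)"
  shows "vector_derivative f (at u) = D"
  by (rule vector_derivative_at, rule has_vector_derivative_transform_within_open[OF assms(4,1,2)])
     (simp add: assms(3))

text \<open>As soon as the exponent has modulus less than \<open>\<pi>\<close>, the principal logarithm of the
  characteristic function is the exponent itself; the second derivative of the exponent is minus
  the Fourier transform of \<open>H\<close>, whose own derivatives at \<open>0\<close> are the moments of \<open>H\<close>.\<close>

lemma cumulants_of_lk_exponent:
  assumes fin: "finite_measure H" and H: "sets H = sets borel"
    and x: "integrable H (\<lambda>x. x)" and x2: "integrable H (\<lambda>x. x\<^sup>2)"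
    and char: "\<And>u. char \<mu> u = exp (CLINT x|H. lk_kernel u x)"
  shows "cumulant 3 \<mu> = (LINT x|H. x)" "cumulant 4 \<mu> = (LINT x|H. x\<^sup>2)"
proof -
  interpret finite_measure H by fact
  note [measurable_cong] = H
  let ?D = "\<lambda>f u. vector_derivative f (at u)"
  let ?p0 = "\<lambda>u. CLINT x|H. lk_kernel u x"
  let ?p1 = "\<lambda>u. CLINT x|H. lk_kernel' u x"
  let ?p3 = "\<lambda>u. - (CLINT x|H. iexp (u * x) * (\<i> * of_real x))"
  let ?p4 = "\<lambda>u. - (CLINT x|H. iexp (u * x) * (- of_real (x\<^sup>2)))"
  let ?f = "\<lambda>u. Ln (char \<mu> u)"
  define m where "m = measure H (space H)"
  (* On S the modulus of the exponent, at most m times u squared over 2, is less than pi. *)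
  define S where "S = {u. u\<^sup>2 / 2 * m < pi}"
  have "open S" unfolding S_def by (intro open_Collect_less continuous_intros) auto
  have S0: "0 \<in> S" by (simp add: S_def)
  have f0: "?f u = ?p0 u" if "u \<in> S" for u
  proof -
    have "norm (?p0 u) \<le> (LINT x|H. norm (lk_kernel u x))"
      by (rule integral_norm_bound)
    also have "\<dots> \<le> (LINT x|H. u\<^sup>2 / 2)"
      by (rule integral_mono) (auto intro!: integrable_norm integrable_lk_kernel fin H norm_lk_kernel_le simp del: le_divide_eq_numeral1)
    also have "\<dots> < pi" using that by (simp add: S_def m_def mult.commute)
    finally have "\<bar>Im (?p0 u)\<bar> < pi" using abs_Im_le_cmod[of "?p0 u"] by linarith
    then show ?thesis unfolding char by (intro Ln_exp) auto
  qed
  have f1: "?D ?f u = ?p1 u" if "u \<in> S" for u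
    by (rule vector_derivative_on_open[OF \<open>open S\<close> that f0 lk_exponent_has_vector_derivative[OF fin H]])
  have f2: "?D (?D ?f) u = - char H u" if "u \<in> S" for u
    by (rule vector_derivative_on_open[OF \<open>open S\<close> that f1 lk_exponent'_has_vector_derivative[OF fin H]])
  have f3: "?D (?D (?D ?f)) u = ?p3 u" if "u \<in> S" for u
    by (rule vector_derivative_on_open[OF \<open>open S\<close> that f2
        has_vector_derivative_minus[OF char_has_vector_derivative[OF fin H x]]])
  have f4: "?D (?D (?D (?D ?f))) u = ?p4 u" if "u \<in> S" for u
    by (rule vector_derivative_on_open[OF \<open>open S\<close> that f3
        has_vector_derivative_minus[OF char_has_vector_derivative2[OF fin H x x2]]])
  have "cumulant 3 \<mu> = Re (?p3 0 / \<i> ^ 3)"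
    unfolding cumulant_def f3[OF S0, symmetric] by (simp add: eval_nat_numeral)
  also have "?p3 0 = - \<i> * of_real (LINT x|H. x)"
    by simp
  finally show "cumulant 3 \<mu> = (LINT x|H. x)" by (simp add: power3_eq_cube)
  have "cumulant 4 \<mu> = Re (?p4 0 / \<i> ^ 4)"
    unfolding cumulant_def f4[OF S0, symmetric] by (simp add: eval_nat_numeral)
  also have "?p4 0 = of_real (LINT x|H. x\<^sup>2)"
    by (simp del: of_real_power)
  finally show "cumulant 4 \<mu> = (LINT x|H. x\<^sup>2)" by simp
qed

section \<open>The supremum of a perturbed quotient\<close>

lemma square_mult_divide: "x \<noteq> 0 \<Longrightarrow> (x * x) * (y / x) = x * (y :: real)"
  by simp

text \<open>The function \<open>G\<close> abstracts the reciprocal \<open>1 / M\<close>.  The last assumption excludes that the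
  supremum of \<open>\<Psi> 0\<close> is approached away from \<open>0\<close>.\<close>

locale reciprocal_expansion =
  fixes G :: "real \<Rightarrow> real" and m1 \<kappa> :: real
  assumes m1: "0 < m1" and \<kappa>: "0 < \<kappa>" and G0: "\<And>t. 0 < t \<Longrightarrow> 0 \<le> G t"
    and expansion: "((\<lambda>t. (G t - 1 + m1 * t) / t\<^sup>2) \<longlongrightarrow> \<kappa>) (at_right 0)"
    and away: "\<And>d. 0 < d \<Longrightarrow> \<exists>\<eta>>0. \<forall>t\<ge>d. (1 - G t) / t \<le> m1 - \<eta>"
begin

definition \<Psi> :: "real \<Rightarrow> real \<Rightarrow> real" where
  "\<Psi> \<epsilon> t = (1 - (1 + \<epsilon>) * G t) / t"

lemma \<Psi>_expand:
  assumes "0 < t" "h = (G t - 1 + m1 * t) / t\<^sup>2"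
  shows "\<Psi> \<epsilon> t = (1 + \<epsilon>) * m1 - \<epsilon> / t - (1 + \<epsilon>) * h * t"
proof -
  have "h * t\<^sup>2 = G t - 1 + m1 * t" using assms(1) unfolding assms(2) by simp
  then have g: "G t = 1 - m1 * t + h * t * t" by (simp add: power2_eq_square mult.assoc)
  have "(1 - (1 + \<epsilon>) * (1 - m1 * t + h * t * t)) = ((1 + \<epsilon>) * m1 - (1 + \<epsilon>) * h * t) * t - \<epsilon>"
    by (simp add: algebra_simps)
  then show ?thesis unfolding \<Psi>_def g using assms(1) by (simp add: diff_divide_distrib)
qed

lemma \<Psi>_le_\<Psi>_0: "0 \<le> \<epsilon> \<Longrightarrow> 0 < t \<Longrightarrow> \<Psi> \<epsilon> t \<le> \<Psi> 0 t"
  using G0[of t] unfolding \<Psi>_def by (intro divide_right_mono diff_left_mono mult_right_mono) auto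

lemma near_0:
  assumes "0 < e"
  obtains d where "0 < d" "\<And>t. 0 < t \<Longrightarrow> t < d \<Longrightarrow>
    \<kappa> * (1 - e) \<le> (G t - 1 + m1 * t) / t\<^sup>2 \<and> (G t - 1 + m1 * t) / t\<^sup>2 \<le> \<kappa> * (1 + e)"
proof -
  have "\<kappa> * (1 - e) < \<kappa>" "\<kappa> < \<kappa> * (1 + e)" using \<kappa> assms by (simp_all add: algebra_simps)
  then have "eventually (\<lambda>t. \<kappa> * (1 - e) < (G t - 1 + m1 * t) / t\<^sup>2 \<and> (G t - 1 + m1 * t) / t\<^sup>2 < \<kappa> * (1 + e)) (at_right 0)"
    using expansion by (intro eventually_conj order_tendstoD)
  then show thesis
    unfolding eventually_at_right_field using that by (metis less_imp_le)
qed

lemma eventually_sqrt_small: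
  assumes "0 < c"
  shows "eventually (\<lambda>\<epsilon>. 0 < \<epsilon> \<and> \<epsilon> < c \<and> sqrt \<epsilon> < c) (at_right 0)"
proof -
  have "((\<lambda>\<epsilon>. sqrt \<epsilon>) \<longlongrightarrow> sqrt 0) (at_right 0)"
    by (intro tendsto_intros)
  then have "eventually (\<lambda>\<epsilon>. sqrt \<epsilon> < c) (at_right 0)"
    using assms by (intro order_tendstoD(2)) simp_all
  moreover have "eventually (\<lambda>\<epsilon>. 0 < \<epsilon> \<and> \<epsilon> < c) (at_right 0)"
    using eventually_at_right_less[of 0] eventually_at_right_real[OF assms] by eventually_elim auto
  ultimately show ?thesis by eventually_elim simp
qed

lemma \<Psi>_near_le:
  assumes "0 < t" "0 \<le> \<epsilon>" "0 \<le> e" "e \<le> 1" "\<kappa> * (1 - e) \<le> (G t - 1 + m1 * t) / t\<^sup>2"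
  shows "\<Psi> \<epsilon> t \<le> (1 + \<epsilon>) * m1 - \<epsilon> / t - \<kappa> * (1 - e) * t"
proof -
  let ?h = "(G t - 1 + m1 * t) / t\<^sup>2"
  have h0: "0 \<le> ?h" using assms \<kappa> by (meson order_trans mult_nonneg_nonneg diff_ge_0_iff_ge less_imp_le)
  have "\<kappa> * (1 - e) * t \<le> ?h * t" using assms by (intro mult_right_mono) auto
  also have "\<dots> \<le> \<dots> + \<epsilon> * (?h * t)"
    using h0 assms by (intro le_add_same_cancel1[THEN iffD2] mult_nonneg_nonneg) auto
  also have "\<dots> = (1 + \<epsilon>) * ?h * t" by (simp only: distrib_right mult_1 mult.assoc)
  finally show ?thesis using \<Psi>_expand[OF assms(1) refl, of \<epsilon>] by linarith
qed

text \<open>Near \<open>0\<close> the inequality of arithmetic and geometric means applies to \<open>\<epsilon> / t + \<kappa> t\<close>; away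
  from \<open>0\<close> the gap \<open>\<eta>\<close> exceeds \<open>2 sqrt (\<kappa> \<epsilon>)\<close> once \<open>\<epsilon>\<close> is small.\<close>

lemma \<Psi>_upper:
  assumes e: "0 < e" "e < 1"
  shows "eventually (\<lambda>\<epsilon>. \<forall>t>0. \<Psi> \<epsilon> t \<le> (1 + \<epsilon>) * m1 - 2 * (1 - e) * sqrt (\<kappa> * \<epsilon>)) (at_right 0)"
proof -
  obtain d where d: "0 < d" and near: "\<And>t. 0 < t \<Longrightarrow> t < d \<Longrightarrow> \<kappa> * (1 - e) \<le> (G t - 1 + m1 * t) / t\<^sup>2"
    using near_0[OF e(1)] by metis
  obtain \<eta> where \<eta>: "0 < \<eta>" and far: "\<And>t. d \<le> t \<Longrightarrow> (1 - G t) / t \<le> m1 - \<eta>"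
    using away[OF d] by blast
  have "0 < \<eta> / (2 * sqrt \<kappa>)" using \<eta> \<kappa> by simp
  from eventually_sqrt_small[OF this] show ?thesis
  proof eventually_elim
    case (elim \<epsilon>)
    have r: "2 * sqrt (\<kappa> * \<epsilon>) < \<eta>" using elim \<kappa> by (simp add: real_sqrt_mult field_simps)
    have r0: "0 \<le> sqrt (\<kappa> * \<epsilon>)" using elim \<kappa> by simp
    show ?case
    proof (intro allI impI)
      fix t :: real assume t: "0 < t"
      show "\<Psi> \<epsilon> t \<le> (1 + \<epsilon>) * m1 - 2 * (1 - e) * sqrt (\<kappa> * \<epsilon>)"
      proof (cases "t < d")
        case True
        have "2 * sqrt (\<epsilon> / t * (\<kappa> * t)) \<le> \<epsilon> / t + \<kappa> * t"
          using arith_geo_mean_sqrt[of "\<epsilon> / t" "\<kappa> * t"] elim t \<kappa> by simp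
        then have "2 * sqrt (\<kappa> * \<epsilon>) \<le> \<epsilon> / t + \<kappa> * t" using t by (simp add: mult.commute)
        then have "(1 - e) * (2 * sqrt (\<kappa> * \<epsilon>)) \<le> (1 - e) * (\<epsilon> / t + \<kappa> * t)"
          using e by (intro mult_left_mono) auto
        moreover have "(1 - e) * (\<epsilon> / t) \<le> 1 * (\<epsilon> / t)"
          using e elim t by (intro mult_right_mono) auto
        ultimately have "2 * (1 - e) * sqrt (\<kappa> * \<epsilon>) \<le> \<epsilon> / t + \<kappa> * (1 - e) * t"
          by (simp add: algebra_simps)
        then show ?thesis
          using \<Psi>_near_le[OF t _ _ _ near[OF t True], of \<epsilon>] elim e by linarith
      next
        case False
        then have "\<Psi> \<epsilon> t \<le> m1 - \<eta>"
          using \<Psi>_le_\<Psi>_0[of \<epsilon> t] far[of t] t elim by (simp add: \<Psi>_def)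
        also have "\<dots> \<le> m1 - 2 * sqrt (\<kappa> * \<epsilon>)" using r by simp
        also have "\<dots> \<le> (1 + \<epsilon>) * m1 - 2 * (1 - e) * sqrt (\<kappa> * \<epsilon>)"
        proof -
          have "(1 - e) * sqrt (\<kappa> * \<epsilon>) \<le> 1 * sqrt (\<kappa> * \<epsilon>)"
            using e r0 by (intro mult_right_mono) auto
          moreover have "0 \<le> \<epsilon> * m1" using elim m1 by simp
          ultimately show ?thesis by (simp add: algebra_simps)
        qed
        finally show ?thesis .
      qed
    qed
  qed
qed

text \<open>Evaluation at the minimiser of \<open>\<epsilon> / t + \<kappa> t\<close>.\<close>

lemma \<Psi>_lower:
  assumes e: "0 < e" "e \<le> 1"
  shows "eventually (\<lambda>\<epsilon>. m1 - 2 * (1 + e) * sqrt (\<kappa> * \<epsilon>) \<le> \<Psi> \<epsilon> (sqrt (\<epsilon> / \<kappa>))) (at_right 0)"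
proof -
  have "0 < e / 2" using e by simp
  then obtain d where d: "0 < d" and near: "\<And>t. 0 < t \<Longrightarrow> t < d \<Longrightarrow>
      (G t - 1 + m1 * t) / t\<^sup>2 \<le> \<kappa> * (1 + e / 2)"
    using near_0 by metis
  have "0 < min e (d * sqrt \<kappa>)" using e d \<kappa> by simp
  from eventually_sqrt_small[OF this] show ?thesis
  proof eventually_elim
    case (elim \<epsilon>)
    define t where "t = sqrt (\<epsilon> / \<kappa>)"
    define r where "r = sqrt (\<kappa> * \<epsilon>)"
    have t: "0 < t" "t < d" using elim \<kappa> by (simp_all add: t_def real_sqrt_divide pos_divide_less_eq)
    have sk: "sqrt \<kappa> * sqrt \<kappa> = \<kappa>" "sqrt \<epsilon> * sqrt \<epsilon> = \<epsilon>" using \<kappa> elim by simp_all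
    have kt: "\<kappa> * t = r"
    proof -
      have "\<kappa> * t = (sqrt \<kappa> * sqrt \<kappa>) * (sqrt \<epsilon> / sqrt \<kappa>)" unfolding sk by (simp add: t_def real_sqrt_divide)
      also have "\<dots> = sqrt \<kappa> * sqrt \<epsilon>"
        by (rule square_mult_divide) (use \<kappa> in simp)
      finally show ?thesis by (simp add: r_def real_sqrt_mult)
    qed
    have et: "\<epsilon> / t = r"
    proof -
      have "\<epsilon> / t = (\<kappa> * \<epsilon>) / (\<kappa> * t)" using \<kappa> by simp
      also have "\<kappa> * \<epsilon> = r * r" using \<kappa> elim by (simp add: r_def)
      also have "r * r / (\<kappa> * t) = r" unfolding kt by simp
      finally show ?thesis .
    qed
    let ?h = "(G t - 1 + m1 * t) / t\<^sup>2"
    have "(1 + \<epsilon>) * ?h * t \<le> (1 + e) * (\<kappa> * (1 + e / 2)) * t"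
    proof (intro mult_right_mono)
      have "(1 + \<epsilon>) * ?h \<le> (1 + \<epsilon>) * (\<kappa> * (1 + e / 2))"
        using near[OF t] elim by (intro mult_left_mono) auto
      also have "\<dots> \<le> (1 + e) * (\<kappa> * (1 + e / 2))"
        using elim e \<kappa> by (intro mult_right_mono) auto
      finally show "(1 + \<epsilon>) * ?h \<le> (1 + e) * (\<kappa> * (1 + e / 2))" .
    qed (use t in simp)
    also have "\<dots> = (1 + e) * (1 + e / 2) * r" unfolding kt[symmetric] by simp
    also have "\<dots> \<le> (1 + 2 * e) * r"
    proof (rule mult_right_mono)
      have "e * e \<le> e * 1" using e by (intro mult_left_mono) auto
      then show "(1 + e) * (1 + e / 2) \<le> 1 + 2 * e" by (simp add: field_simps)
    qed (use elim \<kappa> in \<open>simp add: r_def\<close>)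
    finally have "(1 + \<epsilon>) * ?h * t \<le> (1 + 2 * e) * r" .
    moreover have "0 \<le> \<epsilon> * m1" using elim m1 by simp
    ultimately have "m1 - 2 * (1 + e) * r \<le> \<Psi> \<epsilon> t"
      unfolding \<Psi>_expand[OF t(1) refl, of \<epsilon>] et by (simp add: algebra_simps)
    then show ?case by (simp add: t_def r_def)
  qed
qed

text \<open>With \<open>s = t / sqrt (\<epsilon> / \<kappa>)\<close>, a maximiser has to satisfy \<open>1 / s + (1 - e) s \<le> 2 + 3 e\<close> because
  its value is at least the one at \<open>s = 1\<close>.  As \<open>(s - 1)\<^sup>2 = s (s + 1 / s - 2)\<close>, this forces \<open>s\<close>
  to be near \<open>1\<close>.\<close>

lemma argmax_scaled:
  assumes d: "0 < \<delta>"
  shows "eventually (\<lambda>\<epsilon>. \<forall>t>0. (\<forall>s>0. \<Psi> \<epsilon> s \<le> \<Psi> \<epsilon> t) \<longrightarrow> \<bar>t / sqrt (\<epsilon> / \<kappa>) - 1\<bar> < \<delta>) (at_right 0)"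
proof -
  (* The computation below ends with the bound 28 e for the square of s - 1. *)
  define e where "e = min (1 / 4) (\<delta>\<^sup>2 / 29)"
  have e: "0 < e" "e \<le> 1 / 4" "28 * e < \<delta>\<^sup>2" using d by (auto simp: e_def min_def)
  obtain d where d: "0 < d" and near: "\<And>t. 0 < t \<Longrightarrow> t < d \<Longrightarrow> \<kappa> * (1 - e) \<le> (G t - 1 + m1 * t) / t\<^sup>2"
    using near_0[OF e(1)] by metis
  obtain \<eta> where \<eta>: "0 < \<eta>" and far: "\<And>t. d \<le> t \<Longrightarrow> (1 - G t) / t \<le> m1 - \<eta>"
    using away[OF d] by blast
  have c: "0 < min (\<eta> / (4 * sqrt \<kappa>)) (e * sqrt \<kappa> / m1)" using \<eta> \<kappa> e m1 by simp
  have e1: "e \<le> 1" using e by simp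
  from eventually_sqrt_small[OF c] \<Psi>_lower[OF e(1) e1] show ?thesis
  proof eventually_elim
    case (elim \<epsilon>)
    define r where "r = sqrt (\<kappa> * \<epsilon>)"
    have r: "0 < r" "4 * r < \<eta>" using elim \<kappa> by (simp_all add: r_def real_sqrt_mult field_simps)
    have sk: "sqrt \<kappa> * sqrt \<kappa> = \<kappa>" "sqrt \<epsilon> * sqrt \<epsilon> = \<epsilon>" using \<kappa> elim by simp_all
    have em: "\<epsilon> * m1 \<le> e * r"
    proof -
      have "sqrt \<epsilon> * m1 \<le> e * sqrt \<kappa>" using elim m1 by (simp add: pos_less_divide_eq)
      then have "sqrt \<epsilon> * (sqrt \<epsilon> * m1) \<le> sqrt \<epsilon> * (e * sqrt \<kappa>)"
        using elim by (intro mult_left_mono) auto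
      moreover have "sqrt \<epsilon> * (sqrt \<epsilon> * m1) = \<epsilon> * m1"
        unfolding mult.assoc[symmetric] sk ..
      ultimately show ?thesis by (simp only: r_def real_sqrt_mult mult_ac)
    qed
    show ?case
    proof (intro allI impI)
      fix t assume t: "0 < t" and max: "\<forall>s>0. \<Psi> \<epsilon> s \<le> \<Psi> \<epsilon> t"
      define s where "s = t / sqrt (\<epsilon> / \<kappa>)"
      have s: "0 < s" using t elim \<kappa> by (simp add: s_def)
      have ts: "t = s * (sqrt \<epsilon> / sqrt \<kappa>)" using elim \<kappa> by (simp add: s_def real_sqrt_divide)
      have "0 < sqrt (\<epsilon> / \<kappa>)" using elim \<kappa> by simp
      with max have "\<Psi> \<epsilon> (sqrt (\<epsilon> / \<kappa>)) \<le> \<Psi> \<epsilon> t" by blast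
      with elim have low: "m1 - 2 * (1 + e) * r \<le> \<Psi> \<epsilon> t" unfolding r_def by linarith
      have er: "e * r \<le> 1 * r" using e r by (intro mult_right_mono) auto
      have "t < d"
      proof (rule ccontr)
        assume "\<not> t < d"
        then have "\<Psi> \<epsilon> t \<le> m1 - \<eta>"
          using \<Psi>_le_\<Psi>_0[of \<epsilon> t] far[of t] t elim by (simp add: \<Psi>_def)
        then show False using low r er by (simp add: algebra_simps)
      qed
      then have up: "\<Psi> \<epsilon> t \<le> (1 + \<epsilon>) * m1 - \<epsilon> / t - \<kappa> * (1 - e) * t"
        using \<Psi>_near_le[OF t _ _ _ near[OF t], of \<epsilon>] elim e by auto
      have kt: "\<kappa> * t = r * s"
      proof -
        have "\<kappa> * t = ((sqrt \<kappa> * sqrt \<kappa>) * (sqrt \<epsilon> / sqrt \<kappa>)) * s"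
          unfolding sk ts by (simp add: mult_ac)
        also have "(sqrt \<kappa> * sqrt \<kappa>) * (sqrt \<epsilon> / sqrt \<kappa>) = r"
          unfolding r_def real_sqrt_mult by (rule square_mult_divide) (use \<kappa> in simp)
        finally show ?thesis .
      qed
      have et: "\<epsilon> / t = r * (1 / s)"
      proof -
        have "\<epsilon> / t = (\<kappa> * \<epsilon>) / (\<kappa> * t)" using \<kappa> by simp
        also have "\<kappa> * \<epsilon> = r * r" using \<kappa> elim by (simp add: r_def)
        also have "r * r / (\<kappa> * t) = r * (1 / s)" unfolding kt using r by simp
        finally show ?thesis .
      qed
      have "\<kappa> * (1 - e) * t = (r * s) * (1 - e)" unfolding kt[symmetric] by simp
      with up et have "r * (1 / s + (1 - e) * s) \<le> r * (2 + 3 * e)"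
        using low em by (simp add: algebra_simps)
      then have b: "1 / s + (1 - e) * s \<le> 2 + 3 * e" using r by (simp only: mult_le_cancel_left_pos)
      have "3 / 4 * s \<le> (1 - e) * s" using e s by (intro mult_right_mono) auto
      moreover have "0 < 1 / s" using s by simp
      ultimately have s4: "s \<le> 4" using b e by linarith
      have "s + 1 / s - 2 \<le> 3 * e + e * s" using b by (simp add: algebra_simps)
      also have "\<dots> \<le> 3 * e + e * 4" using s4 e by (intro add_left_mono mult_left_mono) auto
      finally have "s * (s + 1 / s - 2) \<le> s * (7 * e)" using s by (intro mult_left_mono) auto
      also have "\<dots> \<le> 4 * (7 * e)" using s4 e by (intro mult_right_mono) auto
      also have "\<dots> < \<delta>\<^sup>2" using e by simp
      finally have "(s - 1)\<^sup>2 < \<delta>\<^sup>2" using s by (simp add: power2_eq_square algebra_simps)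
      then show "\<bar>t / sqrt (\<epsilon> / \<kappa>) - 1\<bar> < \<delta>"
        using assms unfolding s_def[symmetric]
          by (intro power2_less_imp_less[of "\<bar>s - 1\<bar>"]) simp_all
    qed
  qed
qed

end

text \<open>The assumptions say that \<open>C \<epsilon>\<close> is the least nonnegative upper bound of \<open>\<Psi> \<epsilon>\<close> on the positive
  half-line.\<close>

locale reciprocal_expansion_sup = reciprocal_expansion +
  fixes C :: "real \<Rightarrow> real"
  assumes C_least: "\<And>\<epsilon> c. 0 \<le> \<epsilon> \<Longrightarrow> 0 \<le> c \<Longrightarrow> (\<And>t. 0 < t \<Longrightarrow> \<Psi> \<epsilon> t \<le> c) \<Longrightarrow> C \<epsilon> \<le> c"
    and C_upper: "\<And>\<epsilon> t. 0 \<le> \<epsilon> \<Longrightarrow> 0 < t \<Longrightarrow> \<Psi> \<epsilon> t \<le> C \<epsilon>"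
begin

text \<open>The supremum of \<open>\<Psi> 0\<close> is not attained; its values approach \<open>m1\<close> as \<open>t\<close> tends to \<open>0\<close>.\<close>

lemma C_0: "C 0 = m1"
proof (rule antisym)
  show "C 0 \<le> m1"
  proof (rule C_least)
    fix t :: real assume "0 < t"
    then obtain \<eta> where "0 < \<eta>" "(1 - G t) / t \<le> m1 - \<eta>" using away by blast
    then show "\<Psi> 0 t \<le> m1" by (simp add: \<Psi>_def)
  qed (use m1 in auto)
  show "m1 \<le> C 0"
  proof (rule field_le_epsilon)
    fix y :: real assume y: "0 < y"
    obtain d where d: "0 < d" and near: "\<And>t. 0 < t \<Longrightarrow> t < d \<Longrightarrow> (G t - 1 + m1 * t) / t\<^sup>2 \<le> \<kappa> * (1 + 1)"
      using near_0[of 1] by (metis zero_less_one)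
    define t where "t = min (d / 2) (y / (2 * \<kappa>))"
    have t: "0 < t" "t < d" "t \<le> y / (2 * \<kappa>)" using d y \<kappa> by (auto simp: t_def)
    have "(G t - 1 + m1 * t) / t\<^sup>2 * t \<le> \<kappa> * (1 + 1) * t"
      using near[OF t(1,2)] t by (intro mult_right_mono) auto
    also have "\<dots> \<le> y" using t(3) \<kappa> by (simp add: pos_le_divide_eq mult_ac)
    finally have "m1 - y \<le> \<Psi> 0 t"
      using \<Psi>_expand[OF t(1) refl, of 0] by simp
    with C_upper[of 0 t] t show "m1 \<le> C 0 + y" by simp
  qed
qed

text \<open>Besides being an upper bound of \<open>\<Psi> \<epsilon>\<close>, the right-hand side has to be nonnegative; it is
  eventually, because \<open>m1\<close> is positive.\<close>

lemma C_le:
  assumes e: "0 < e" "e < 1"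
  shows "eventually (\<lambda>\<epsilon>. C \<epsilon> \<le> (1 + \<epsilon>) * m1 - 2 * (1 - e) * sqrt (\<kappa> * \<epsilon>)) (at_right 0)"
proof -
  have "0 < m1 / (2 * sqrt \<kappa>)" using m1 \<kappa> by simp
  from \<Psi>_upper[OF e] eventually_sqrt_small[OF this] show ?thesis
  proof eventually_elim
    case (elim \<epsilon>)
    have r: "2 * sqrt (\<kappa> * \<epsilon>) < m1" using elim \<kappa> by (simp add: real_sqrt_mult field_simps)
    have "(1 - e) * sqrt (\<kappa> * \<epsilon>) \<le> 1 * sqrt (\<kappa> * \<epsilon>)"
      using e elim \<kappa> by (intro mult_right_mono) auto
    moreover have "0 \<le> \<epsilon> * m1" using elim m1 by simp
    ultimately have "0 \<le> (1 + \<epsilon>) * m1 - 2 * (1 - e) * sqrt (\<kappa> * \<epsilon>)"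
      using r by (simp add: algebra_simps)
    with elim show ?case by (intro C_least) auto
  qed
qed

lemma C_asymptotics:
  "(\<lambda>\<epsilon>. C \<epsilon> - (m1 - 2 * sqrt (\<kappa> * \<epsilon>))) \<in> o[at_right 0](\<lambda>\<epsilon>. sqrt \<epsilon>)"
proof (rule landau_o.smallI)
  fix c :: real assume c: "0 < c"
  define e where "e = min (1 / 2) (c / (3 * sqrt \<kappa>))"
  have e: "0 < e" "e < 1" "e \<le> 1" "3 * e * sqrt \<kappa> \<le> c"
    using c \<kappa> by (auto simp: e_def min_def field_simps)
  have "0 < e * sqrt \<kappa> / m1" using e \<kappa> m1 by simp
  from C_le[OF e(1,2)] \<Psi>_lower[OF e(1,3)] eventually_sqrt_small[OF this]
  show "eventually (\<lambda>\<epsilon>. norm (C \<epsilon> - (m1 - 2 * sqrt (\<kappa> * \<epsilon>))) \<le> c * norm (sqrt \<epsilon>)) (at_right 0)"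
  proof eventually_elim
    case (elim \<epsilon>)
    define r where "r = sqrt (\<kappa> * \<epsilon>)"
    have sk: "sqrt \<epsilon> * sqrt \<epsilon> = \<epsilon>" using elim by simp
    have em: "\<epsilon> * m1 \<le> e * r"
    proof -
      have "sqrt \<epsilon> * m1 \<le> e * sqrt \<kappa>" using elim m1 by (simp add: pos_less_divide_eq)
      then have "sqrt \<epsilon> * (sqrt \<epsilon> * m1) \<le> sqrt \<epsilon> * (e * sqrt \<kappa>)"
        using elim by (intro mult_left_mono) auto
      moreover have "sqrt \<epsilon> * (sqrt \<epsilon> * m1) = \<epsilon> * m1"
        unfolding mult.assoc[symmetric] sk ..
      ultimately show ?thesis by (simp only: r_def real_sqrt_mult mult_ac)
    qed
    have er: "0 \<le> e * r" using e elim \<kappa> by (simp add: r_def)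
    have "\<Psi> \<epsilon> (sqrt (\<epsilon> / \<kappa>)) \<le> C \<epsilon>" using elim \<kappa> by (intro C_upper) auto
    then have "m1 - 2 * (1 + e) * r \<le> C \<epsilon>" using elim by (simp add: r_def)
    moreover have "C \<epsilon> \<le> (1 + \<epsilon>) * m1 - 2 * (1 - e) * r" using elim by (simp add: r_def)
    ultimately have "\<bar>C \<epsilon> - (m1 - 2 * r)\<bar> \<le> 3 * (e * r)"
      using em er by (simp add: algebra_simps abs_le_iff)
    also have "\<dots> = (3 * e * sqrt \<kappa>) * sqrt \<epsilon>" by (simp add: r_def real_sqrt_mult)
    also have "\<dots> \<le> c * sqrt \<epsilon>" using e elim by (intro mult_right_mono) auto
    finally show ?case using elim by (simp add: r_def)
  qed
qed

text \<open>By \<open>C_le\<close> with \<open>e = 1 / 2\<close>, the difference \<open>C \<epsilon> - m1\<close> is at most \<open>\<epsilon> m1 - sqrt (\<kappa> \<epsilon>)\<close>, and the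
  square root dominates.\<close>

lemma C_slope:
  assumes V: "0 < V"
  shows "filterlim (\<lambda>\<epsilon>. (C \<epsilon> - m1) / (\<epsilon> * V)) at_bot (at_right 0)"
  unfolding filterlim_at_bot
proof
  fix K :: real
  have "0 < m1 + V * \<bar>K\<bar>" using m1 V by (simp add: add_pos_nonneg)
  then have c: "0 < sqrt \<kappa> / (m1 + V * \<bar>K\<bar>)" using \<kappa> by simp
  have "eventually (\<lambda>\<epsilon>. C \<epsilon> \<le> (1 + \<epsilon>) * m1 - 2 * (1 - 1 / 2) * sqrt (\<kappa> * \<epsilon>)) (at_right 0)"
    by (rule C_le) simp_all
  from this eventually_sqrt_small[OF c]
  show "eventually (\<lambda>\<epsilon>. (C \<epsilon> - m1) / (\<epsilon> * V) \<le> K) (at_right 0)"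
  proof eventually_elim
    case (elim \<epsilon>)
    have "sqrt \<epsilon> * (m1 + V * \<bar>K\<bar>) \<le> sqrt \<kappa>"
      using elim \<open>0 < m1 + V * \<bar>K\<bar>\<close> by (simp add: pos_less_divide_eq)
    then have "sqrt \<epsilon> * (sqrt \<epsilon> * (m1 + V * \<bar>K\<bar>)) \<le> sqrt \<epsilon> * sqrt \<kappa>"
      using elim by (intro mult_left_mono) auto
    moreover have "sqrt \<epsilon> * (sqrt \<epsilon> * (m1 + V * \<bar>K\<bar>)) = \<epsilon> * m1 + \<epsilon> * V * \<bar>K\<bar>"
      using elim unfolding mult.assoc[symmetric] by (simp add: distrib_left)
    ultimately have "\<epsilon> * m1 - sqrt (\<kappa> * \<epsilon>) \<le> - (\<epsilon> * V * \<bar>K\<bar>)"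
      by (simp add: real_sqrt_mult mult.commute)
    moreover have "C \<epsilon> - m1 \<le> \<epsilon> * m1 - sqrt (\<kappa> * \<epsilon>)" using elim by (simp add: algebra_simps)
    moreover have "\<epsilon> * V * (- \<bar>K\<bar>) \<le> \<epsilon> * V * K" using elim V by (intro mult_left_mono) auto
    ultimately have "C \<epsilon> - m1 \<le> K * (\<epsilon> * V)" by (simp add: mult.commute)
    then show ?case using elim V by (simp add: pos_divide_le_eq)
  qed
qed

end

section \<open>Expansion of one-sided moment generating functions\<close>

lemma mgf_pos:
  assumes "real_distribution \<rho>"
  shows "0 < mgf \<rho> t"
proof -
  interpret real_distribution \<rho> by fact
  have "mgf \<rho> t \<noteq> 0"
  proof
    assume "mgf \<rho> t = 0"
    then have "AE x in \<rho>. exp (t * x) \<le> 0"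
      unfolding mgf_def by (subst (asm) nn_integral_0_iff_AE) auto
    then have "AE x in \<rho>. False" by simp
    then show False using AE_False by blast
  qed
  then show ?thesis by (simp add: zero_less_iff_neq_zero)
qed

lemma exp_le_exp_endpoint: "0 \<le> s \<Longrightarrow> s \<le> t \<Longrightarrow> exp (s * x) \<le> 1 + exp (t * x)" for x :: real
proof (cases "0 \<le> x")
  case True
  assume "0 \<le> s" "s \<le> t"
  then have "exp (s * x) \<le> exp (t * x)" using True by (simp add: mult_right_mono)
  then show ?thesis by linarith
next
  case False
  assume "0 \<le> s" "s \<le> t"
  then have "exp (s * x) \<le> 1" using False by (simp add: mult_nonneg_nonpos)
  then show ?thesis using exp_ge_zero[of "t * x"] by linarith
qed

lemma mgf_integrable:
  assumes "real_distribution \<rho>" "mgf \<rho> t < \<infinity>" "0 \<le> s" "s \<le> t"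
  shows "integrable \<rho> (\<lambda>x. exp (s * x))"
proof -
  interpret real_distribution \<rho> by fact
  have i: "integrable \<rho> (\<lambda>x. exp (t * x))"
    using assms(2) by (intro integrableI_nonneg) (auto simp: mgf_def)
  show ?thesis
    by (rule Bochner_Integration.integrable_bound[of _ "\<lambda>x. 1 + exp (t * x)"])
       (use i exp_le_exp_endpoint[OF assms(3,4)] in auto)
qed

lemma mgf_eq_integral:
  assumes "real_distribution \<rho>" "integrable \<rho> (\<lambda>x. exp (t * x))"
  shows "mgf \<rho> t = ennreal (LINT x|\<rho>. exp (t * x))" "0 < (LINT x|\<rho>. exp (t * x))"
proof -
  show m: "mgf \<rho> t = ennreal (LINT x|\<rho>. exp (t * x))"
    unfolding mgf_def by (rule nn_integral_eq_integral[OF assms(2)]) simp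
  show "0 < (LINT x|\<rho>. exp (t * x))"
    using mgf_pos[OF assms(1), of t] unfolding m by simp
qed

lemma Psi_eq:
  assumes "0 \<le> \<theta>"
  shows "Psi \<rho> \<theta> t = (1 - \<theta> * enn2real (1 / mgf \<rho> t)) / t"
proof -
  have "ennreal \<theta> / mgf \<rho> t = ennreal \<theta> * (1 / mgf \<rho> t)"
    by (simp add: ennreal_times_divide)
  then show ?thesis using assms by (simp add: Psi_def enn2real_mult)
qed

text \<open>Exponential moments are assumed on the positive side only; on the negative side, second moments
  take their place.\<close>

locale one_sided_mgf = real_distribution \<rho> for \<rho> +
  fixes t0 :: real
  assumes int1: "integrable \<rho> (\<lambda>r. r)" and int2: "integrable \<rho> (\<lambda>r. r\<^sup>2)"
    and t0: "0 < t0" and mgf_t0: "mgf \<rho> t0 < \<infinity>"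
begin

definition F :: "real \<Rightarrow> real" where "F t = (LINT r|\<rho>. exp (t * r))"

lemma int_exp: "0 \<le> t \<Longrightarrow> t \<le> t0 \<Longrightarrow> integrable \<rho> (\<lambda>r. exp (t * r))"
  using mgf_integrable[OF real_distribution_axioms mgf_t0] .

lemma mgf_F: "0 \<le> t \<Longrightarrow> t \<le> t0 \<Longrightarrow> mgf \<rho> t = ennreal (F t)"
  and F_pos: "0 \<le> t \<Longrightarrow> t \<le> t0 \<Longrightarrow> 0 < F t"
  using mgf_eq_integral[OF real_distribution_axioms int_exp] by (simp_all add: F_def)

lemma reciprocal_mgf:
  assumes "0 \<le> t" "t \<le> t0"
  shows "enn2real (1 / mgf \<rho> t) = 1 / F t"
  using F_pos[OF assms] divide_ennreal[of 1 "F t"] by (simp add: mgf_F[OF assms])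

lemma continuous_F: "continuous_on {0..t0} F"
proof (rule continuous_on_sequentiallyI)
  fix u a assume u: "\<forall>n. u n \<in> {0..t0}" and a: "a \<in> {0..t0}" and lim: "u \<longlonglongrightarrow> a"
  show "(\<lambda>n. F (u n)) \<longlonglongrightarrow> F a"
    unfolding F_def
  proof (rule integral_dominated_convergence[where w="\<lambda>r. 1 + exp (t0 * r)"])
    show "integrable \<rho> (\<lambda>r. 1 + exp (t0 * r))" using int_exp[of t0] t0 by simp
    show "AE r in \<rho>. (\<lambda>n. exp (u n * r)) \<longlonglongrightarrow> exp (a * r)"
      by (intro AE_I2 tendsto_intros lim)
    show "AE r in \<rho>. norm (exp (u n * r)) \<le> 1 + exp (t0 * r)" for n
      using u exp_le_exp_endpoint[of "u n" t0] by (intro AE_I2) auto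
  qed auto
qed

text \<open>The dominating function for the second-order expansion.  For \<open>r \<le> 0\<close> the remainder is at most
  its quadratic term; for \<open>r > 0\<close> half of the exponential moment at \<open>t0\<close> absorbs the factor
  \<open>r\<^sup>2\<close>.\<close>

lemma exp_kernel_bound:
  assumes "0 \<le> t" "t \<le> t0 / 2"
  shows "exp_kernel r t \<le> r\<^sup>2 / 2 + 4 / t0\<^sup>2 * exp (t0 * r)"
proof (cases "t = 0")
  case True
  then show ?thesis using t0 by (simp add: exp_kernel_def)
next
  case False
  with assms have t: "0 < t" by simp
  have k: "exp_kernel r t = (exp (r * t) - 1 - r * t) / t\<^sup>2" using False by (simp add: exp_kernel_def)
  show ?thesis
  proof (cases "r \<le> 0")
    case True
    then have "r * t \<le> 0" using t by (simp add: mult_nonpos_nonneg)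
    then have "exp_kernel r t \<le> (r * t)\<^sup>2 / 2 / t\<^sup>2"
      unfolding k by (intro divide_right_mono exp_taylor_bounds(3)) auto
    also have "\<dots> = r\<^sup>2 / 2" using t by (simp add: power_mult_distrib)
    finally show ?thesis using t0 by (simp add: add_increasing2)
  next
    case False
    then have r: "0 < r" by simp
    define y where "y = t0 * r / 2"
    have y: "0 \<le> y" using r t0 by (simp add: y_def)
    have "y\<^sup>2 / 2 \<le> exp y" using exp_lower_Taylor_quadratic[OF y] y by linarith
    then have r2: "r\<^sup>2 / 2 \<le> 4 / t0\<^sup>2 * exp y"
      using t0 by (simp add: y_def power2_eq_square field_simps)
    have "exp_kernel r t \<le> r\<^sup>2 / 2 * exp \<bar>r * t\<bar>" by (rule exp_kernel_le)
    also have "\<dots> \<le> (4 / t0\<^sup>2 * exp y) * exp y"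
    proof (intro mult_mono r2)
      have "r * t \<le> r * (t0 / 2)" using r assms by (intro mult_left_mono) auto
      then show "exp \<bar>r * t\<bar> \<le> exp y" using r t by (simp add: y_def mult.commute)
    qed (use t0 in auto)
    also have "\<dots> = 4 / t0\<^sup>2 * exp (t0 * r)" by (simp add: y_def exp_add[symmetric])
    finally show ?thesis by (simp add: add_increasing)
  qed
qed

text \<open>The kernel is used with its arguments exchanged: \<open>q t\<close> is the expectation of
  \<open>(exp (t r) - 1 - t r) / t\<^sup>2\<close>, extended by its limit at \<open>t = 0\<close>.\<close>

definition q :: "real \<Rightarrow> real" where "q t = (LINT r|\<rho>. exp_kernel r t)"

lemma measurable_exp_kernel_fst [measurable]: "(\<lambda>r. exp_kernel r t) \<in> borel_measurable borel"
  unfolding exp_kernel_def by measurable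

lemma int_dom: "integrable \<rho> (\<lambda>r. r\<^sup>2 / 2 + 4 / t0\<^sup>2 * exp (t0 * r))"
  using int_exp[of t0] int2 t0 by auto

lemma F_taylor:
  assumes "0 < t" "t \<le> t0 / 2"
  shows "F t = 1 + (LINT r|\<rho>. r) * t + q t * t\<^sup>2"
proof -
  have i: "integrable \<rho> (\<lambda>r. exp_kernel r t)"
    by (rule Bochner_Integration.integrable_bound[OF int_dom])
       (use exp_kernel_bound[of t] exp_kernel_nonneg assms in \<open>auto simp: abs_of_nonneg exp_kernel_nonneg intro: order_trans[OF _ abs_ge_self]\<close>)
  have "F t = (LINT r|\<rho>. 1 + r * t + exp_kernel r t * t\<^sup>2)"
    unfolding F_def using assms
    by (intro Bochner_Integration.integral_cong) (simp_all add: exp_kernel_def mult.commute)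
  also have "\<dots> = 1 + (LINT r|\<rho>. r) * t + q t * t\<^sup>2"
    unfolding q_def by (simp add: i int1 prob_space del: space_eq_univ)
  finally show ?thesis .
qed

lemma q_tendsto: "(q \<longlongrightarrow> (LINT r|\<rho>. r\<^sup>2) / 2) (at_right 0)"
  unfolding tendsto_at_iff_sequentially
proof (intro allI impI)
  fix X :: "nat \<Rightarrow> real" assume X0: "\<forall>i. X i \<in> {0<..} - {0}" and X: "X \<longlonglongrightarrow> 0"
  have "eventually (\<lambda>n. X n < t0 / 2) sequentially"
    using t0 by (intro order_tendstoD(2)[OF X]) simp
  then obtain k where k: "\<And>n. k \<le> n \<Longrightarrow> X n < t0 / 2" unfolding eventually_sequentially by blast
  define Y where "Y = (\<lambda>n. X (n + k))"
  have Y: "0 < Y n" "Y n \<le> t0 / 2" for n using k[of "n + k"] X0 by (auto simp: Y_def less_imp_le)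
  have Ylim: "Y \<longlonglongrightarrow> 0" unfolding Y_def using X by (rule LIMSEQ_ignore_initial_segment)
  have Yat: "filterlim Y (at 0) sequentially"
    unfolding filterlim_at using Ylim Y(1) by (auto simp: less_imp_neq[symmetric])
  have "(\<lambda>n. q (Y n)) \<longlonglongrightarrow> (LINT r|\<rho>. r\<^sup>2 / 2)"
    unfolding q_def
  proof (rule integral_dominated_convergence[OF _ _ int_dom])
    show "AE r in \<rho>. (\<lambda>n. exp_kernel r (Y n)) \<longlonglongrightarrow> r\<^sup>2 / 2"
    proof (rule AE_I2)
      fix r
      show "(\<lambda>n. exp_kernel r (Y n)) \<longlonglongrightarrow> r\<^sup>2 / 2"
      proof -
        have e: "exp_kernel r 0 = r\<^sup>2 / 2" by (simp add: exp_kernel_def)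
        show ?thesis unfolding e[symmetric]
          by (rule filterlim_compose[OF exp_kernel_tendsto_0 Yat])
      qed
    qed
    show "AE r in \<rho>. norm (exp_kernel r (Y n)) \<le> r\<^sup>2 / 2 + 4 / t0\<^sup>2 * exp (t0 * r)" for n
      unfolding real_norm_def abs_of_nonneg[OF exp_kernel_nonneg]
      using Y[of n] by (intro AE_I2 exp_kernel_bound) auto
  qed measurable
  also have "(LINT r|\<rho>. r\<^sup>2 / 2) = (LINT r|\<rho>. r\<^sup>2) / 2" by simp
  finally show "(q \<circ> X) \<longlonglongrightarrow> (LINT r|\<rho>. r\<^sup>2) / 2"
    unfolding Y_def comp_def by (rule LIMSEQ_offset)
qed

text \<open>The \<open>t\<^sup>2\<close> coefficient of the reciprocal of \<open>1 + m1 t + q t\<^sup>2\<close> is \<open>m1\<^sup>2 - q\<close>.\<close>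

lemma reciprocal_mgf_expansion:
  fixes m1 m2
  defines "m1 \<equiv> (LINT r|\<rho>. r)" and "m2 \<equiv> (LINT r|\<rho>. r\<^sup>2)"
  shows "((\<lambda>t. (enn2real (1 / mgf \<rho> t) - 1 + m1 * t) / t\<^sup>2) \<longlongrightarrow> m1\<^sup>2 - m2 / 2) (at_right 0)"
proof -
  let ?R = "\<lambda>t. (m1\<^sup>2 - q t + m1 * q t * t) / (1 + m1 * t + q t * t\<^sup>2)"
  have q: "(q \<longlongrightarrow> m2 / 2) (at_right 0)" using q_tendsto by (simp add: m2_def)
  have "(?R \<longlongrightarrow> (m1\<^sup>2 - m2 / 2 + m1 * (m2 / 2) * 0) / (1 + m1 * 0 + m2 / 2 * 0\<^sup>2)) (at_right 0)"
    by (intro tendsto_intros q) simp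
  then have "(?R \<longlongrightarrow> m1\<^sup>2 - m2 / 2) (at_right 0)" by simp
  moreover have "eventually (\<lambda>t. ?R t = (enn2real (1 / mgf \<rho> t) - 1 + m1 * t) / t\<^sup>2) (at_right 0)"
  proof -
    have "eventually (\<lambda>t. t < t0 / 2 \<and> 0 < t) (at_right 0)"
      using eventually_at_right_real[of 0 "t0 / 2"] t0 by (auto elim: eventually_mono)
    then show ?thesis
    proof eventually_elim
      case (elim t)
      then have tt: "0 \<le> t" "t \<le> t0" using t0 by auto
      have F: "F t = 1 + m1 * t + q t * t\<^sup>2" using F_taylor[of t] elim by (simp add: m1_def)
      have Fp: "F t \<noteq> 0" using F_pos[OF tt] by simp
      have "1 - (1 - m1 * t) * F t = t\<^sup>2 * (m1\<^sup>2 - q t + m1 * q t * t)"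
        unfolding F by (simp add: algebra_simps power2_eq_square)
      moreover have "1 / F t - 1 + m1 * t = (1 - (1 - m1 * t) * F t) / F t"
        using Fp by (simp add: field_simps)
      ultimately show ?case
        unfolding reciprocal_mgf[OF tt] F[symmetric] using elim by simp
    qed
  qed
  ultimately show ?thesis by (rule Lim_transform_eventually)
qed

text \<open>On \<open>[d, t0]\<close> the function is continuous and attains its maximum; beyond \<open>t0\<close> it is at most
  \<open>1 / t0\<close>, which is less than \<open>m\<close>.\<close>

lemma Psi_1_away_from_0:
  assumes lt: "\<And>t. 0 < t \<Longrightarrow> Psi \<rho> 1 t < m" and m: "0 < m" "1 / m < t0" and d: "0 < d"
  shows "\<exists>\<eta>>0. \<forall>t\<ge>d. Psi \<rho> 1 t \<le> m - \<eta>"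
proof -
  have far: "Psi \<rho> 1 t \<le> m - (m - 1 / t0)" if "t0 \<le> t" for t
  proof -
    have "Psi \<rho> 1 t \<le> 1 / t"
      using that t0 by (simp add: Psi_eq divide_right_mono)
    also have "\<dots> \<le> 1 / t0" using that t0 by (simp add: frac_le)
    finally show ?thesis by simp
  qed
  have f0: "0 < m - 1 / t0" using m t0 by (simp add: field_simps)
  show ?thesis
  proof (cases "d \<le> t0")
    case True
    let ?f = "\<lambda>t. (1 - 1 / F t) / t"
    have "continuous_on {d..t0} ?f"
      using d F_pos by (intro continuous_intros continuous_on_subset[OF continuous_F]) (auto simp: less_imp_neq[symmetric])
    then obtain s where s: "s \<in> {d..t0}" "\<And>t. t \<in> {d..t0} \<Longrightarrow> ?f t \<le> ?f s"
      using continuous_attains_sup[of "{d..t0}" ?f] True by auto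
    have P: "Psi \<rho> 1 t = ?f t" if "t \<in> {d..t0}" for t
      using that d reciprocal_mgf[of t] by (simp add: Psi_eq)
    define \<eta> where "\<eta> = min (m - Psi \<rho> 1 s) (m - 1 / t0)"
    have "0 < \<eta>" using lt[of s] s d f0 by (auto simp: \<eta>_def)
    moreover have "Psi \<rho> 1 t \<le> m - \<eta>" if "d \<le> t" for t
    proof (cases "t \<le> t0")
      case True
      then have "Psi \<rho> 1 t \<le> Psi \<rho> 1 s" using s P that by simp
      then show ?thesis by (simp add: \<eta>_def)
    next
      case False
      then show ?thesis using far[of t] by (simp add: \<eta>_def)
    qed
    ultimately show ?thesis by blast
  next
    case False
    then show ?thesis using far f0 by (intro exI[of _ "m - 1 / t0"]) auto
  qed
qed

end

section \<open>From the Levy-Khintchine representation to the quotient\<close>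

text \<open>The fourth-moment condition makes \<open>x\<close> integrable over the large jumps, so the truncated
  compensator can be replaced by the full one at the cost of a drift.  The mean being zero removes the total drift, the variance gives the mass,
  and uniqueness of characteristic functions identifies \<open>\<mu>\<close> with the constructed law.\<close>

lemma levy_khintchine_kolmogorov:
  fixes \<mu> \<nu> :: "real measure" and a V :: real
  assumes \<mu>: "real_distribution \<mu>" and x: "integrable \<mu> (\<lambda>x. x)" "(LINT x|\<mu>. x) = 0"
    and x2: "integrable \<mu> (\<lambda>x. x\<^sup>2)" "(LINT x|\<mu>. x\<^sup>2) = V" and V: "0 < V"
    and LK: "has_levy_khintchine \<mu> a \<nu>"
    and tail: "set_integrable \<nu> {x. \<bar>x\<bar> > 1} (\<lambda>x. x ^ 4)"
  shows "levy_size_bias V a \<nu>" "kolmogorov_law \<mu> (levy_H a \<nu>)"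
    "integrable (levy_H a \<nu>) (\<lambda>x. x)" "integrable (levy_H a \<nu>) (\<lambda>x. x\<^sup>2)"
proof -
  let ?H = "levy_H a \<nu>"
  define T where "T = {x::real. \<bar>x\<bar> > 1}"
  have [measurable]: "T \<in> sets borel" unfolding T_def by measurable
  have a: "0 \<le> a" and lm: "levy_measure \<nu>" using LK by (auto simp: has_levy_khintchine_def)
  obtain b where b: "\<And>u. char \<mu> u = exp (\<i> * of_real (b * u) - of_real (a * u\<^sup>2 / 2) +
      (CLINT x|\<nu>. iexp (u * x) - 1 - \<i> * of_real (u * x * indicator {-1..1} x)))"
    using LK unfolding has_levy_khintchine_def by blast
  have \<nu>: "sets \<nu> = sets borel" and small: "(\<integral>\<^sup>+x. ennreal (min 1 (x\<^sup>2)) \<partial>\<nu>) < \<infinity>"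
    using lm by (auto simp: levy_measure_def)
  note [measurable_cong] = \<nu>
  have i4: "integrable \<nu> (\<lambda>x. indicator T x * x ^ 4)"
    using tail by (simp add: set_integrable_def T_def)
  have imin: "integrable \<nu> (\<lambda>x. min 1 (x\<^sup>2))"
    using small by (intro integrableI_nonneg) auto
  have dom: "integrable \<nu> f"
    if f[measurable]: "f \<in> borel_measurable borel" and "\<And>x. norm (f x) \<le> min 1 (x\<^sup>2) + indicator T x * x ^ 4"
    for f :: "real \<Rightarrow> real"
    by (rule Bochner_Integration.integrable_bound[OF Bochner_Integration.integrable_add[OF imin i4]])
       (use that(2) in \<open>auto intro: order_trans[OF _ abs_ge_self]\<close>)
  have big: "x\<^sup>2 \<le> x ^ 4" "\<bar>x\<bar> \<le> x ^ 4" if "1 < \<bar>x\<bar>" for x :: real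
  proof -
    have "\<bar>x\<bar> ^ 2 \<le> \<bar>x\<bar> ^ 4" "\<bar>x\<bar> ^ 1 \<le> \<bar>x\<bar> ^ 4"
      using that by (intro power_increasing; simp)+
    then show "x\<^sup>2 \<le> x ^ 4" "\<bar>x\<bar> \<le> x ^ 4" by simp_all
  qed
  have sm: "x\<^sup>2 \<le> 1" "x ^ 4 \<le> x\<^sup>2" if "\<not> 1 < \<bar>x\<bar>" for x :: real
  proof -
    have "\<bar>x\<bar> ^ 2 \<le> 1" "\<bar>x\<bar> ^ 4 \<le> \<bar>x\<bar> ^ 2"
      using that by (auto intro!: power_le_one power_decreasing simp del: power2_abs power_even_abs_numeral)
    then show "x\<^sup>2 \<le> 1" "x ^ 4 \<le> x\<^sup>2" by simp_all
  qed
  have i2: "integrable \<nu> (\<lambda>x. x\<^sup>2)"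
  proof (rule dom)
    show "norm (x\<^sup>2) \<le> min 1 (x\<^sup>2) + indicator T x * x ^ 4" for x :: real
      using big(1)[of x] sm(1)[of x] by (cases "1 < \<bar>x\<bar>") (auto simp: T_def indicator_def intro: add_increasing)
  qed simp
  have i4': "integrable \<nu> (\<lambda>x. x ^ 4)"
  proof (rule dom)
    show "norm (x ^ 4) \<le> min 1 (x\<^sup>2) + indicator T x * x ^ 4" for x :: real
      using sm[of x] by (cases "1 < \<bar>x\<bar>") (auto simp: T_def indicator_def intro: add_increasing)
  qed simp
  have i1: "integrable \<nu> (\<lambda>x. x * indicator T x)"
  proof (rule dom)
    show "norm (x * indicator T x) \<le> min 1 (x\<^sup>2) + indicator T x * x ^ 4" for x :: real
      using big(2)[of x] by (cases "1 < \<bar>x\<bar>") (auto simp: T_def indicator_def intro: add_increasing)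
  qed simp
  have fin: "finite_measure ?H"
  proof
    have "emeasure ?H (space ?H) = (\<integral>\<^sup>+x. 1 \<partial>?H)" by simp
    also have "\<dots> = ennreal a + (\<integral>\<^sup>+x. ennreal (x\<^sup>2) \<partial>\<nu>)"
      by (subst nn_integral_levy_H[OF \<nu>]) simp_all
    also have "(\<integral>\<^sup>+x. ennreal (x\<^sup>2) \<partial>\<nu>) = ennreal (LINT x|\<nu>. x\<^sup>2)"
      using i2 by (intro nn_integral_eq_integral) auto
    finally show "emeasure ?H (space ?H) \<noteq> \<infinity>" by simp
  qed
  interpret H: finite_measure ?H by (rule fin)
  show H2: "integrable ?H (\<lambda>x. x\<^sup>2)"
    using i4' by (subst integrable_levy_H_iff[OF \<nu>]) (simp_all add: power_add[symmetric])
  show H1: "integrable ?H (\<lambda>x. x)"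
  proof (rule Bochner_Integration.integrable_bound[OF Bochner_Integration.integrable_add[OF H.integrable_const[of 1] H2]])
    have "\<bar>x\<bar> \<le> 1 + x\<^sup>2" for x :: real
      using sum_squares_bound[of "\<bar>x\<bar>" 1] by simp
    then show "AE x in ?H. norm x \<le> norm (1 + x\<^sup>2)" by simp
  qed simp
  define \<beta> where "\<beta> = (LINT x|\<nu>. x * indicator T x)"
  have ch: "char \<mu> u = exp (\<i> * of_real ((b + \<beta>) * u) + (CLINT x|?H. lk_kernel u x))" for u
  proof -
    have il: "integrable \<nu> (\<lambda>x. x\<^sup>2 *\<^sub>R lk_kernel u x)"
      using integrable_lk_kernel[OF fin sets_levy_H, of u] by (subst (asm) integrable_levy_H_iff[OF \<nu>]) simp_all
    have ib: "integrable \<nu> (\<lambda>x. \<i> * of_real u * of_real (x * indicator T x))"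
      using i1 by (intro integrable_mult_right) (simp only: complex_of_real_integrable_eq)
    have "(CLINT x|\<nu>. iexp (u * x) - 1 - \<i> * of_real (u * x * indicator {-1..1} x)) =
        (CLINT x|\<nu>. x\<^sup>2 *\<^sub>R lk_kernel u x + \<i> * of_real u * of_real (x * indicator T x))"
    proof (rule Bochner_Integration.integral_cong[OF refl])
      fix x :: real
      have e: "x\<^sup>2 *\<^sub>R lk_kernel u x = iexp (u * x) - 1 - \<i> * of_real (u * x)"
        by (simp add: lk_kernel_def scaleR_conv_of_real)
      show "iexp (u * x) - 1 - \<i> * of_real (u * x * indicator {-1..1} x) =
          x\<^sup>2 *\<^sub>R lk_kernel u x + \<i> * of_real u * of_real (x * indicator T x)"
        unfolding e by (cases "1 < \<bar>x\<bar>") (auto simp: T_def indicator_def)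
    qed
    also have "\<dots> = (CLINT x|\<nu>. x\<^sup>2 *\<^sub>R lk_kernel u x) + \<i> * of_real u * of_real \<beta>"
      unfolding \<beta>_def Bochner_Integration.integral_add[OF il ib]
      by (simp only: integral_mult_right_zero integral_complex_of_real)
    also have "(CLINT x|\<nu>. x\<^sup>2 *\<^sub>R lk_kernel u x) = (CLINT x|?H. lk_kernel u x) + of_real (a * u\<^sup>2 / 2)"
      unfolding integral_levy_H[OF \<nu> a integrable_lk_kernel[OF fin sets_levy_H]]
      by (simp add: lk_kernel_def[of u 0] scaleR_conv_of_real)
    finally show ?thesis unfolding b by (simp add: algebra_simps)
  qed
  note dm = lk_drift_and_mass[OF \<mu> x x2(1) fin sets_levy_H ch]
  have "measure ?H UNIV = V" using dm(2) x2(2) by simp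
  then show "levy_size_bias V a \<nu>"
    using V \<nu> by unfold_locales (simp_all add: H.emeasure_eq_measure)
  obtain P where P: "kolmogorov_law P ?H"
    using kolmogorov_law_exists[OF fin sets_levy_H] by blast
  have "\<mu> = P"
  proof (rule Levy_uniqueness[OF \<mu>])
    show "real_distribution P" using P by (simp add: kolmogorov_law_def)
    show "char \<mu> = char P" using P dm(1) by (simp add: kolmogorov_law_def ch fun_eq_iff)
  qed
  then show "kolmogorov_law \<mu> ?H" using P by simp
qed

lemma cgf_0: "real_distribution \<mu> \<Longrightarrow> cgf \<mu> 0 = 0"
  using prob_space.emeasure_space_1[of \<mu>] by (simp add: cgf_def mgf_def real_distribution_def)

text \<open>For \<open>c t < 1\<close> both inequalities say \<open>(1 - c t) M(t) \<le> \<theta>\<close>; for \<open>c t \<ge> 1\<close> the feasibility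
  condition is void and \<open>\<Psi>\<^sub>\<theta>(t) \<le> 1 / t \<le> c\<close>.\<close>

lemma feasible_iff_Psi_le:
  assumes \<mu>: "real_distribution \<mu>" and \<rho>: "real_distribution \<rho>" and V: "0 < V" and \<theta>: "0 < \<theta>"
    and K: "\<And>t. 0 < t \<Longrightarrow> mgf \<mu> t = exp_ennreal (ennreal (V * t\<^sup>2 / 2) * mgf \<rho> t)"
  shows "feasible \<mu> (\<theta> * V) c \<longleftrightarrow> 0 \<le> c \<and> (\<forall>t>0. Psi \<rho> \<theta> t \<le> c)"
proof -
  have main: "((c = 0 \<or> t < 1 / c) \<longrightarrow> cgf \<mu> t \<le> ereal (\<theta> * V * t\<^sup>2 / (2 * (1 - c * t)))) \<longleftrightarrow> Psi \<rho> \<theta> t \<le> c"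
    if c: "0 \<le> c" and t: "0 < t" for t
  proof -
    have win: "(c = 0 \<or> t < 1 / c) \<longleftrightarrow> 0 < 1 - c * t"
      using c by (cases "c = 0") (auto simp: field_simps)
    have Vt: "0 < V * t\<^sup>2 / 2" using V t by simp
    show ?thesis
    proof (cases "mgf \<rho> t")
      case top
      have "ennreal (V * t\<^sup>2 / 2) \<noteq> 0" using Vt by (simp only: ennreal_eq_0_iff not_le)
      then have "mgf \<mu> t = \<infinity>" by (simp only: K[OF t] top ennreal_mult_top exp_ennreal_top) simp
      then have "cgf \<mu> t = \<infinity>" by (simp add: cgf_def)
      moreover have "Psi \<rho> \<theta> t = 1 / t" by (simp add: Psi_def top)
      moreover have "1 / t \<le> c \<longleftrightarrow> \<not> 0 < 1 - c * t" using t by (auto simp: field_simps)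
      ultimately show ?thesis using win by simp
    next
      case (real F)
      have F: "0 < F" using mgf_pos[OF \<rho>, of t] real by simp
      have "mgf \<mu> t = ennreal (exp (V * t\<^sup>2 / 2 * F))"
        using Vt F by (simp add: K[OF t] real ennreal_mult[symmetric])
      then have cg: "cgf \<mu> t = ereal (V * t\<^sup>2 / 2 * F)" by (simp add: cgf_def)
      have P: "Psi \<rho> \<theta> t \<le> c \<longleftrightarrow> (1 - c * t) * F \<le> \<theta>"
      proof -
        have e: "Psi \<rho> \<theta> t = (1 - \<theta> / F) / t"
          using \<theta> F by (simp add: Psi_def real divide_ennreal)
        have "Psi \<rho> \<theta> t \<le> c \<longleftrightarrow> 1 - \<theta> / F \<le> c * t"
          unfolding e using t by (simp only: pos_divide_le_eq)
        also have "\<dots> \<longleftrightarrow> 1 - c * t \<le> \<theta> / F" by linarith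
        also have "\<dots> \<longleftrightarrow> (1 - c * t) * F \<le> \<theta>" using F by (simp only: pos_le_divide_eq)
        finally show ?thesis .
      qed
      show ?thesis
      proof (cases "0 < 1 - c * t")
        case True
        have "V * t\<^sup>2 / 2 * F \<le> \<theta> * V * t\<^sup>2 / (2 * (1 - c * t)) \<longleftrightarrow>
            (V * t\<^sup>2 / 2) * ((1 - c * t) * F) \<le> (V * t\<^sup>2 / 2) * \<theta>"
        proof -
          have "\<theta> * V * t\<^sup>2 / (2 * (1 - c * t)) = (V * t\<^sup>2 / 2) * \<theta> / (1 - c * t)" by simp
          then show ?thesis using True by (simp only: pos_le_divide_eq) (simp only: mult_ac)
        qed
        also have "\<dots> \<longleftrightarrow> (1 - c * t) * F \<le> \<theta>" using Vt by (rule mult_le_cancel_left_pos)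
        finally show ?thesis unfolding P cg win using True by simp
      next
        case False
        then have "(1 - c * t) * F \<le> 0" using F by (simp add: mult_nonpos_nonneg)
        then show ?thesis unfolding P win using False \<theta> by simp
      qed
    qed
  qed
  have zero: "cgf \<mu> 0 \<le> ereal (\<theta> * V * 0\<^sup>2 / (2 * (1 - c * 0)))"
    by (simp add: cgf_0[OF \<mu>])
  show ?thesis
  proof
    assume "feasible \<mu> (\<theta> * V) c"
    then show "0 \<le> c \<and> (\<forall>t>0. Psi \<rho> \<theta> t \<le> c)"
      using main unfolding feasible_def by (meson less_imp_le)
  next
    assume *: "0 \<le> c \<and> (\<forall>t>0. Psi \<rho> \<theta> t \<le> c)"
    have "(c = 0 \<or> t < 1 / c) \<longrightarrow> cgf \<mu> t \<le> ereal (\<theta> * V * t\<^sup>2 / (2 * (1 - c * t)))" if "0 \<le> t" for t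
      using that zero main[of t] * by (cases "t = 0") auto
    then show "feasible \<mu> (\<theta> * V) c"
      unfolding feasible_def using * \<theta> V by simp
  qed
qed

section \<open>Asymptotics of the optimal constant\<close>

theorem theorem5p1:
  fixes M :: "'w measure" and X :: "'w \<Rightarrow> real"
    and \<mu> \<nu> \<rho> :: "real measure" and a V m1 m2 \<kappa> :: real
  assumes "prob_space M" and "X \<in> borel_measurable M"
    and "integrable M X" and "integrable M (\<lambda>w. (X w)\<^sup>2)"
    and "prob_space.expectation M X = 0"
    and "V = prob_space.variance M X" and "0 < V"
    and "\<mu> = distr M borel X"
    and "infinitely_divisible \<mu>"
    and "has_levy_khintchine \<mu> a \<nu>"
    and "set_integrable \<nu> {x. \<bar>x\<bar> > 1} (\<lambda>x. x ^ 4)"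
    and "\<rho> = law_R V a \<nu>"
    and "m1 = (LINT r|\<rho>. r)" and "m2 = (LINT r|\<rho>. r\<^sup>2)"
    and "\<kappa> = m1\<^sup>2 - m2 / 2"
    and "0 < exp_abscissa \<mu>"
    and "0 < m1" and "0 < \<kappa>"
    and "\<forall>t>0. Psi \<rho> 1 t < m1"
    and "exp_abscissa \<mu> < \<infinity> \<longrightarrow> 1 / exp_abscissa \<mu> < ereal m1"
  shows "(m1 = cumulant 3 \<mu> / (3 * V)) \<and>
    (m2 = cumulant 4 \<mu> / (6 * V)) \<and>
    (\<kappa> = (cumulant 3 \<mu>)\<^sup>2 / (9 * V\<^sup>2) - cumulant 4 \<mu> / (12 * V)) \<and>
    (\<forall>\<^sub>F \<epsilon> in at_right 0. \<bar>cstar \<mu> ((1 + \<epsilon>) * V)\<bar> \<noteq> \<infinity>) \<and>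
    ((\<lambda>\<epsilon>. real_of_ereal (cstar \<mu> ((1 + \<epsilon>) * V)) - (m1 - 2 * sqrt (\<kappa> * \<epsilon>)))
           \<in> o[at_right 0](\<lambda>\<epsilon>. sqrt \<epsilon>)) \<and>
    (\<forall>\<delta>>0. \<forall>\<^sub>F \<epsilon> in at_right 0. \<forall>t.
           is_arg_max (Psi \<rho> (1 + \<epsilon>)) (\<lambda>t. 0 < t) t \<longrightarrow> \<bar>t / sqrt (\<epsilon> / \<kappa>) - 1\<bar> < \<delta>) \<and>
    (\<bar>cstar \<mu> V\<bar> \<noteq> \<infinity>) \<and>
    (filterlim (\<lambda>v. (real_of_ereal (cstar \<mu> v) - real_of_ereal (cstar \<mu> V)) / (v - V))
           at_bot (at_right V))"
proof -
  interpret M: prob_space M by fact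
  have X[measurable]: "X \<in> borel_measurable M" by fact
  have \<mu>: "real_distribution \<mu>"
    unfolding \<open>\<mu> = distr M borel X\<close> by (intro borel_real_distribution M.prob_space_distr) simp_all
  have x: "integrable \<mu> (\<lambda>x. x)" "(LINT x|\<mu>. x) = 0"
    and x2: "integrable \<mu> (\<lambda>x. x\<^sup>2)" "(LINT x|\<mu>. x\<^sup>2) = V"
    using assms(3-6) unfolding \<open>\<mu> = distr M borel X\<close>
    by (simp_all add: integrable_distr_eq integral_distr)
  have V: "0 < V" by fact
  let ?H = "levy_H a \<nu>"
  note lk = levy_khintchine_kolmogorov[OF \<mu> x x2 V \<open>has_levy_khintchine \<mu> a \<nu>\<close> assms(11)]
  interpret S: levy_size_bias V a \<nu> by (rule lk(1))
  have \<rho>_eq: "\<rho> = S.\<rho>" by fact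
  have \<rho>: "real_distribution \<rho>" unfolding \<rho>_eq by (rule S.real_distribution_law_R)
  have int1: "integrable \<rho> (\<lambda>r. r)" and mean: "m1 = (LINT x|?H. x) / (3 * V)"
    using S.law_R_moment[of 1] integral_beta12_id lk(3) unfolding \<open>m1 = _\<close> \<rho>_eq by simp_all
  have int2: "integrable \<rho> (\<lambda>r. r\<^sup>2)" and square: "m2 = (LINT x|?H. x\<^sup>2) / (6 * V)"
    using S.law_R_moment[of 2] integral_beta12_square lk(4) unfolding \<open>m2 = _\<close> \<rho>_eq by simp_all
  have char\<mu>: "char \<mu> u = exp (CLINT x|?H. lk_kernel u x)" for u
    using lk(2) by (simp add: kolmogorov_law_def)
  note cumulants = cumulants_of_lk_exponent[OF S.finite_H sets_levy_H lk(3,4) char\<mu>]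
  have K: "mgf \<mu> t = exp_ennreal (ennreal (V * t\<^sup>2 / 2) * mgf \<rho> t)" if "0 < t" for t
    using lk(2) S.mgf_law_R[of t] that by (simp add: kolmogorov_law_def \<rho>_eq)
  have m1: "0 < m1" and \<kappa>: "0 < \<kappa>" and Psi_lt: "\<And>t. 0 < t \<Longrightarrow> Psi \<rho> 1 t < m1"
    using assms by auto
  have "ereal (1 / m1) < exp_abscissa \<mu>"
  proof (cases "exp_abscissa \<mu>")
    case (real \<tau>)
    then have "0 < \<tau>" "1 / \<tau> < m1" using assms by (auto simp: one_ereal_def)
    then show ?thesis using real m1 by (simp add: field_simps)
  qed (use assms in auto)
  then obtain t0 where t0: "1 / m1 < t0" "0 < t0" "cgf \<mu> t0 < \<infinity>"
    unfolding exp_abscissa_def less_Sup_iff using m1 by auto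
  have "mgf \<rho> t0 < \<infinity>"
  proof (rule ccontr)
    assume "\<not> mgf \<rho> t0 < \<infinity>"
    then have top: "mgf \<rho> t0 = \<infinity>" by (simp add: less_top[symmetric])
    have "0 < V * t0\<^sup>2 / 2" using V t0 by simp
    then have "ennreal (V * t0\<^sup>2 / 2) \<noteq> 0" by (simp only: ennreal_eq_0_iff not_le)
    then have "mgf \<mu> t0 = \<infinity>" by (simp only: K[OF t0(2)] top ennreal_mult_top exp_ennreal_top if_False infinity_ennreal_def)
    then show False using t0(3) by (simp add: cgf_def)
  qed
  then interpret E: one_sided_mgf \<rho> t0
    using \<rho> int1 int2 t0(2) by (simp add: one_sided_mgf_def one_sided_mgf_axioms_def)
  define G where "G = (\<lambda>t. enn2real (1 / mgf \<rho> t))"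
  have G: "Psi \<rho> \<theta> t = (1 - \<theta> * G t) / t" if "0 \<le> \<theta>" for \<theta> t
    using Psi_eq[OF that] by (simp add: G_def)
  define C where "C = (\<lambda>\<epsilon>. real_of_ereal (cstar \<mu> ((1 + \<epsilon>) * V)))"
  have feas: "feasible \<mu> ((1 + \<epsilon>) * V) c \<longleftrightarrow> 0 \<le> c \<and> (\<forall>t>0. (1 - (1 + \<epsilon>) * G t) / t \<le> c)"
    if "0 \<le> \<epsilon>" for \<epsilon> c
    using feasible_iff_Psi_le[OF \<mu> \<rho> V _ K, of "1 + \<epsilon>" c] G[of "1 + \<epsilon>"] that by simp
  have G0: "0 \<le> G t" for t by (simp add: G_def)
  have feas_m1: "feasible \<mu> ((1 + \<epsilon>) * V) m1" if "0 \<le> \<epsilon>" for \<epsilon>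
    unfolding feas[OF that]
  proof (intro conjI allI impI)
    fix t :: real assume t: "0 < t"
    have "(1 - (1 + \<epsilon>) * G t) / t \<le> (1 - 1 * G t) / t"
      using t that G0[of t] by (intro divide_right_mono diff_left_mono mult_right_mono) auto
    also have "\<dots> \<le> m1" using Psi_lt[OF t] G[of 1 t] by simp
    finally show "(1 - (1 + \<epsilon>) * G t) / t \<le> m1" .
  qed (use m1 in simp)
  have cstar_le: "cstar \<mu> v \<le> ereal c" if "feasible \<mu> v c" for v c
    unfolding cstar_def using that by (intro INF_lower) simp
  have cstar_ge: "ereal b \<le> cstar \<mu> v" if "\<And>c. feasible \<mu> v c \<Longrightarrow> b \<le> c" for v b
    unfolding cstar_def using that by (intro INF_greatest) simp
  have fin: "\<bar>cstar \<mu> ((1 + \<epsilon>) * V)\<bar> \<noteq> \<infinity>" if "0 \<le> \<epsilon>" for \<epsilon>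
    using cstar_le[OF feas_m1[OF that]] cstar_ge[of "(1 + \<epsilon>) * V" 0] feas[OF that]
    by (cases "cstar \<mu> ((1 + \<epsilon>) * V)") auto
  then have C: "cstar \<mu> ((1 + \<epsilon>) * V) = ereal (C \<epsilon>)" if "0 \<le> \<epsilon>" for \<epsilon>
    using that by (simp add: C_def ereal_real)
  interpret R: reciprocal_expansion G m1 \<kappa>
  proof
    show "((\<lambda>t. (G t - 1 + m1 * t) / t\<^sup>2) \<longlongrightarrow> \<kappa>) (at_right 0)"
      using E.reciprocal_mgf_expansion assms by (simp add: G_def)
    show "\<exists>\<eta>>0. \<forall>t\<ge>d. (1 - G t) / t \<le> m1 - \<eta>" if "0 < d" for d
      using E.Psi_1_away_from_0[OF Psi_lt m1 t0(1) that] G[of 1] by simp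
  qed (use m1 \<kappa> G0 in auto)
  interpret R: reciprocal_expansion_sup G m1 \<kappa> C
  proof
    fix \<epsilon> c :: real
    assume "0 \<le> \<epsilon>" "0 \<le> c" "\<And>t. 0 < t \<Longrightarrow> R.\<Psi> \<epsilon> t \<le> c"
    then have "cstar \<mu> ((1 + \<epsilon>) * V) \<le> ereal c"
      by (intro cstar_le) (simp add: feas R.\<Psi>_def)
    then show "C \<epsilon> \<le> c" using C \<open>0 \<le> \<epsilon>\<close> by simp
  next
    fix \<epsilon> t :: real
    assume "0 \<le> \<epsilon>" "0 < t"
    then have "ereal (R.\<Psi> \<epsilon> t) \<le> cstar \<mu> ((1 + \<epsilon>) * V)"
      by (intro cstar_ge) (simp add: feas R.\<Psi>_def)
    then show "R.\<Psi> \<epsilon> t \<le> C \<epsilon>" using C \<open>0 \<le> \<epsilon>\<close> by simp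
  qed
  have pos: "eventually (\<lambda>\<epsilon>::real. 0 < \<epsilon>) (at_right 0)" by (rule eventually_at_right_less)
  have "m1 = cumulant 3 \<mu> / (3 * V)" "m2 = cumulant 4 \<mu> / (6 * V)"
    unfolding cumulants using mean square by simp_all
  moreover from this have "\<kappa> = (cumulant 3 \<mu>)\<^sup>2 / (9 * V\<^sup>2) - cumulant 4 \<mu> / (12 * V)"
    unfolding \<open>\<kappa> = _\<close> by (simp add: power_divide power_mult_distrib)
  moreover have "\<forall>\<^sub>F \<epsilon> in at_right 0. \<bar>cstar \<mu> ((1 + \<epsilon>) * V)\<bar> \<noteq> \<infinity>"
    using pos by eventually_elim (rule fin, simp)
  moreover have "(\<lambda>\<epsilon>. real_of_ereal (cstar \<mu> ((1 + \<epsilon>) * V)) - (m1 - 2 * sqrt (\<kappa> * \<epsilon>)))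
      \<in> o[at_right 0](\<lambda>\<epsilon>. sqrt \<epsilon>)"
    using R.C_asymptotics by (simp add: C_def)
  moreover have "\<forall>\<^sub>F \<epsilon> in at_right 0. \<forall>t. is_arg_max (Psi \<rho> (1 + \<epsilon>)) (\<lambda>t. 0 < t) t \<longrightarrow>
      \<bar>t / sqrt (\<epsilon> / \<kappa>) - 1\<bar> < \<delta>" if "0 < \<delta>" for \<delta>
    using pos R.argmax_scaled[OF that]
  proof eventually_elim
    case (elim \<epsilon>)
    then have e: "Psi \<rho> (1 + \<epsilon>) = R.\<Psi> \<epsilon>" by (intro ext) (simp add: G R.\<Psi>_def)
    show ?case
    proof (intro allI impI)
      fix t assume "is_arg_max (Psi \<rho> (1 + \<epsilon>)) (\<lambda>t. 0 < t) t"
      then have "0 < t" "\<forall>s>0. R.\<Psi> \<epsilon> s \<le> R.\<Psi> \<epsilon> t"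
        unfolding e is_arg_max_def by (blast, meson not_less)
      with elim(2) show "\<bar>t / sqrt (\<epsilon> / \<kappa>) - 1\<bar> < \<delta>" by blast
    qed
  qed
  moreover have "\<bar>cstar \<mu> V\<bar> \<noteq> \<infinity>"
    using fin[of 0] by simp
  moreover have "filterlim (\<lambda>v. (real_of_ereal (cstar \<mu> v) - real_of_ereal (cstar \<mu> V)) / (v - V))
      at_bot (at_right V)"
  proof -
    let ?e = "\<lambda>v. (v - V) / V"
    have "filterlim ?e (at_right 0) (at_right V)"
      unfolding filterlim_at
    proof
      have "((\<lambda>v. (v - V) / V) \<longlongrightarrow> (V - V) / V) (at_right V)"
        using V by (intro tendsto_intros) simp
      then show "(?e \<longlongrightarrow> 0) (at_right V)" by simp
      show "\<forall>\<^sub>F v in at_right V. ?e v \<in> {0<..} \<and> ?e v \<noteq> 0"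
        using eventually_at_right_less[of V] by eventually_elim (use V in simp)
    qed
    then have "filterlim (\<lambda>v. (C (?e v) - m1) / (?e v * V)) at_bot (at_right V)"
      by (rule filterlim_compose[OF R.C_slope[OF V]])
    moreover have "(\<lambda>v. (C (?e v) - m1) / (?e v * V)) =
        (\<lambda>v. (real_of_ereal (cstar \<mu> v) - real_of_ereal (cstar \<mu> V)) / (v - V))"
    proof
      fix v
      have "(1 + ?e v) * V = v" using V by (simp add: field_simps)
      moreover have "real_of_ereal (cstar \<mu> V) = m1" using R.C_0 by (simp add: C_def)
      ultimately show "(C (?e v) - m1) / (?e v * V) =
          (real_of_ereal (cstar \<mu> v) - real_of_ereal (cstar \<mu> V)) / (v - V)"
        using V by (simp add: C_def)
    qed
    ultimately show ?thesis by simp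
  qed
  ultimately show ?thesis by blast
qed

end
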